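(* Let $G$ be an $(n,d,\lambda)$-graph with $\lambda\le d/2$. Then for every pair of nodes $s,t$ of $G$ and every $0<\delta<1$, with probability at least $1-\delta$ the BFS + Random Walks algorithm between $s$ and $t$ (with parameter $\delta$) finds an $s$-$t$ path of length $O(\lg_{d/\lambda}(n))$ while visiting $O(\sqrt{n\ln(1/\delta)})$ nodes.
   Context: An $n$-node graph $G$ is an $(n,d,\lambda)$-graph if it is $d$-regular and the eigenvalues $\lambda_1\ge\cdots\ge\lambda_n$ of its adjacency matrix satisfy $\max_{i\neq 1}|\lambda_i|\le\lambda$; $\lg_b$ is the logarithm to base $b$. The BFS + Random Walks algorithm with parameter $\delta$: set $k=\Theta(\sqrt{n\ln(1/\delta)})$ (e.g. $k=\sqrt{7n\ln(1/\delta)}$). First run BFS from $s$ until $k$ nodes have been discovered; call this set $V_s$. Then run $k/(3\lg_{d/\lambda}(n))$ independent simple random walks starting at $t$, each of length $3\lg_{d/\lambda}(n)$. If some walk hits a node of $V_s$, output the $s$-$t$ path consisting of the walk prefix from $t$ to that node followed by the BFS-tree path from that node to $s$.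
   Formalization: The bound O(√(n ln(1/δ))) on visited nodes fails for δ near 1 (it drops below one node); when the prescribed number of walks k/(3 lg_{d/λ} n) is below 1, one walk is run and the bound proved is O(lg_{d/λ} n) visited nodes instead. *)

theory Defs
  imports
    "HOL-Probability.Probability"
    "HOL-Library.While_Combinator"
    "Graph_Theory.Pair_Digraph"
    "Graph_Theory.Vertex_Walk"
    "Jordan_Normal_Form.Char_Poly"
begin

section \<open>Expanders\<close>

text \<open>
  A finite simple undirected graph is a symmetric, loop-free digraph whose arcs are vertex pairs
  (locale \<^locale>\<open>pair_graph\<close>); an \<open>n\<close>-node graph has vertex set \<open>{..<n}\<close>.
\<close>

definition adjacency_matrix :: "nat \<Rightarrow> nat pair_pre_digraph \<Rightarrow> real mat" where
  "adjacency_matrix n G = mat n n (\<lambda>(u, v). if (u, v) \<in> parcs G then 1 else 0)"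

text \<open>
  The list of all eigenvalues, with algebraic multiplicity, in decreasing order. At most one list
  \<open>evs\<close> satisfies this; for a real symmetric matrix there is one.
\<close>

definition ordered_eigenvalues :: "real mat \<Rightarrow> real list \<Rightarrow> bool" where
  "ordered_eigenvalues A evs \<longleftrightarrow>
     char_poly A = (\<Prod>e\<leftarrow>evs. [:- e, 1:]) \<and> sorted_wrt (\<ge>) evs"

definition ndl_graph :: "nat \<Rightarrow> nat \<Rightarrow> real \<Rightarrow> nat pair_pre_digraph \<Rightarrow> bool" where
  "ndl_graph n d lam G \<longleftrightarrow>
     pair_graph G \<and> pverts G = {..<n} \<and>
     (\<forall>v\<in>pverts G. out_degree (with_proj G) v = d) \<and>
     (\<exists>evs. ordered_eigenvalues (adjacency_matrix n G) evs \<and>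
        (\<forall>i\<in>{1..<n}. \<bar>evs ! i\<bar> \<le> lam))"

text \<open>
  The order in which the lists enumerate the neighbours is arbitrary; it determines the order in
  which breadth-first search discovers vertices.
\<close>

definition adjacency_lists :: "nat pair_pre_digraph \<Rightarrow> (nat \<Rightarrow> nat list) \<Rightarrow> bool" where
  "adjacency_lists G nbrs \<longleftrightarrow>
     (\<forall>v\<in>pverts G. distinct (nbrs v) \<and> set (nbrs v) = {u. (v, u) \<in> parcs G})"


section \<open>Breadth-first search until \<open>K\<close> nodes are discovered\<close>

text \<open>
  A state \<open>(Q, T)\<close> consists of the queue and the search tree. The domain of \<open>T\<close> is the set of
  discovered vertices, and \<open>T v\<close> is the tree path \<open>[v, \<dots>, s]\<close> from \<open>v\<close> up to the root.
\<close>

type_synonym bfs_state = "nat list \<times> (nat \<rightharpoonup> nat list)"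

definition discover :: "nat \<Rightarrow> nat \<Rightarrow> nat \<Rightarrow> bfs_state \<Rightarrow> bfs_state" where
  "discover K v u = (\<lambda>(Q, T).
     if u \<in> dom T \<or> card (dom T) \<ge> K then (Q, T)
     else (Q @ [u], T(u \<mapsto> u # the (T v))))"

definition bfs :: "(nat \<Rightarrow> nat list) \<Rightarrow> nat \<Rightarrow> nat \<Rightarrow> (nat \<rightharpoonup> nat list)" where
  "bfs nbrs K s = snd (while
     (\<lambda>(Q, T). Q \<noteq> [] \<and> card (dom T) < K)
     (\<lambda>(Q, T). fold (discover K (hd Q)) (nbrs (hd Q)) (tl Q, T))
     ([s], [s \<mapsto> [s]]))"


section \<open>The algorithm\<close>

text \<open>A walk of length \<open>m\<close> takes \<open>m\<close> steps and is returned as the list of its \<open>m + 1\<close> vertices.\<close>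

primrec random_walk :: "(nat \<Rightarrow> nat list) \<Rightarrow> nat \<Rightarrow> nat \<Rightarrow> nat list pmf" where
  "random_walk nbrs 0 v = return_pmf [v]"
| "random_walk nbrs (Suc m) v =
     bind_pmf (pmf_of_set (set (nbrs v))) (\<lambda>u. map_pmf ((#) v) (random_walk nbrs m u))"

text \<open>
  The first walk that hits the tree is used, up to its first hit; the tree path starts with the
  vertex that was hit. The result is \<open>None\<close> if no walk hits.
\<close>

definition connecting_path :: "(nat \<rightharpoonup> nat list) \<Rightarrow> nat list list \<Rightarrow> nat list option" where
  "connecting_path T ws =
     map_option
       (\<lambda>w. takeWhile (\<lambda>v. v \<notin> dom T) w @ the (T (hd (dropWhile (\<lambda>v. v \<notin> dom T) w))))
       (List.find (\<lambda>w. \<exists>v\<in>set w. v \<in> dom T) ws)"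

text \<open>
  Here \<open>b\<close> is the base \<open>d / \<lambda>\<close> of the logarithm and \<open>k\<close> the real-valued size parameter; the three
  integer quantities are obtained by rounding up. The outcome is the output path, if any, together
  with the set of all nodes visited by the search or by some walk.
\<close>

definition bfs_random_walks ::
    "(nat \<Rightarrow> nat list) \<Rightarrow> nat \<Rightarrow> real \<Rightarrow> real \<Rightarrow> nat \<Rightarrow> nat \<Rightarrow> (nat list option \<times> nat set) pmf" where
  "bfs_random_walks nbrs n b k s t =
     (let T = bfs nbrs (nat \<lceil>k\<rceil>) s;
          walk_length = nat \<lceil>3 * log b (real n)\<rceil>;
          walk_count = nat \<lceil>k / (3 * log b (real n))\<rceil>
      in map_pmf (\<lambda>ws. (connecting_path T ws, dom T \<union> (\<Union>w\<in>set ws. set w)))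
           (replicate_pmf walk_count (random_walk nbrs walk_length t)))"

text \<open>The path is listed starting from \<open>t\<close>; the graph is undirected.\<close>

definition st_path :: "nat pair_pre_digraph \<Rightarrow> nat \<Rightarrow> nat \<Rightarrow> nat list \<Rightarrow> bool" where
  "st_path G s t p \<longleftrightarrow> vwalk p (with_proj G) \<and> hd p = t \<and> last p = s"

end

theory Submission
  imports Defs "Jordan_Normal_Form.Spectral_Radius"
begin

text \<open>
  Put \<open>\<sigma> = \<lambda> / d \<le> 1 / 2\<close> and let \<open>L\<close> be the logarithm of \<open>n\<close> to base \<open>1 / \<sigma>\<close>. On functions
  with sum zero, averaging over the neighbours contracts the Euclidean norm by the factor \<open>\<sigma>\<close>.
  Followed by the restriction to the complement of a set \<open>S\<close> of density \<open>\<mu>\<close>, it therefore has norm at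
  most \<open>1 - (1 - \<sigma>) \<mu> \<le> exp (- \<mu> / 2)\<close> on functions vanishing on \<open>S\<close>. Of the \<open>3 L\<close> steps of a walk,
  the first half makes the influence of the start vertex at most \<open>1 / n \<le> \<mu>\<close>, which the factor
  \<open>1 - \<mu>\<close> for missing \<open>S\<close> at the end absorbs, and each step of the other half gains a factor
  \<open>exp (- \<mu> / 2)\<close>. After rounding, a walk misses \<open>S\<close> with probability at most \<open>exp (- (3 / 7) \<mu> L)\<close>, and
  \<open>k / (3 L)\<close> independent walks miss \<open>V\<^sub>s\<close>, where \<open>\<mu> \<ge> k / n\<close>, with probability at most
  \<open>exp (- k\<^sup>2 / (7 n)) \<le> \<delta>\<close>. The same contraction shows that any two vertices are joined by a walk of
  length about \<open>L\<close>, which bounds the depth of the search tree.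
\<close>

section \<open>The spectral gap\<close>

text \<open>Log-convexity makes the ratios of consecutive terms nondecreasing. A first ratio
  \<open>q > 1\<close> would therefore force geometric growth, against the bound
  \<open>C\<close>.\<close>

lemma log_convex_bounded_step_le:
  fixes a :: "nat \<Rightarrow> real"
  assumes nonneg: "\<And>k. 0 \<le> a k"
    and convex: "\<And>k. (a (Suc k))\<^sup>2 \<le> a k * a (Suc (Suc k))"
    and bounded: "\<And>k. a k \<le> C"
  shows "a 1 \<le> a 0"
proof (rule ccontr)
  assume less: "\<not> a 1 \<le> a 0"
  have a0: "a 0 > 0"
  proof (rule ccontr)
    assume "\<not> a 0 > 0"
    with nonneg[of 0] have "a 0 = 0" by simp
    with convex[of 0] have "a 1 = 0" by simp
    with less \<open>a 0 = 0\<close> show False by simp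
  qed
  define q where "q = a 1 / a 0"
  have q: "q > 1" unfolding q_def using less a0 by simp
  have step: "a k > 0 \<and> q * a k \<le> a (Suc k)" for k
  proof (induction k)
    case 0
    show ?case using a0 by (simp add: q_def)
  next
    case (Suc k)
    have pos: "a (Suc k) > 0" using Suc q by (smt (verit) mult_pos_pos)
    have "(q * a k) * a (Suc k) \<le> a (Suc k) * a (Suc k)"
      using Suc pos by (intro mult_right_mono) auto
    also have "\<dots> \<le> a k * a (Suc (Suc k))"
      using convex[of k] by (simp add: power2_eq_square)
    finally have "a k * (q * a (Suc k)) \<le> a k * a (Suc (Suc k))"
      by (simp add: algebra_simps)
    with Suc pos show ?case by simp
  qed
  have "q ^ k * a 0 \<le> a k" for k
  proof (induction k)
    case (Suc k)
    have "q ^ Suc k * a 0 = q * (q ^ k * a 0)" by simp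
    also have "\<dots> \<le> q * a k" using Suc q by (intro mult_left_mono) auto
    also have "\<dots> \<le> a (Suc k)" using step by blast
    finally show ?case .
  qed simp
  moreover obtain k where "C / a 0 < q ^ k"
    using real_arch_pow[OF q] by blast
  ultimately show False
    using bounded[of k] a0 by (smt (verit, best) divide_less_eq)
qed

lemma scalar_prod_mult_mat_vec_symmetric:
  fixes M :: "real mat"
  assumes M: "M \<in> carrier_mat n n" "transpose_mat M = M"
    and x: "x \<in> carrier_vec n" and y: "y \<in> carrier_vec n"
  shows "(M *\<^sub>v x) \<bullet> y = x \<bullet> (M *\<^sub>v y)"
proof -
  show ?thesis
    using transpose_vec_mult_scalar[OF M(1) y x] M(2) by simp
qed

text \<open>
  The squared norms of the iterates of a symmetric matrix are log-convex, so once they stay bounded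
  they cannot grow in the first step.
\<close>

lemma symmetric_contraction:
  fixes M :: "real mat"
  assumes M: "M \<in> carrier_mat n n" "transpose_mat M = M" and n: "n > 0"
    and eig: "\<And>z. eigenvalue (map_mat complex_of_real M) z \<Longrightarrow> norm z < 1"
    and x: "x \<in> carrier_vec n"
  shows "(M *\<^sub>v x) \<bullet> (M *\<^sub>v x) \<le> x \<bullet> x"
proof -
  let ?C = "map_mat complex_of_real M"
  have C: "?C \<in> carrier_mat n n" using M by auto
  have "spectral_radius ?C < 1"
    using spectral_radius_mem_max(1)[OF C n] eig by (auto simp: spectrum_def)
  \<comment> \<open>Through the Jordan normal form, a spectral radius below 1 bounds the entries of
    all powers by one constant, so the iterates of \<open>x\<close> stay bounded.\<close>
  from spectral_radius_jnf_norm_bound_less_1_upper_triangular[OF C this]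
  obtain c where c: "\<And>k. norm_bound (?C ^\<^sub>m k) c" by blast
  have entry: "\<bar>(M ^\<^sub>m k) $$ (i, j)\<bar> \<le> c" if "i < n" "j < n" for i j k
  proof -
    have "?C ^\<^sub>m k = map_mat complex_of_real (M ^\<^sub>m k)"
      by (rule of_real_hom.mat_hom_pow[OF M(1), symmetric])
    with c[of k] that show ?thesis
      using pow_carrier_mat[OF M(1), of k] M(1) by (auto simp: norm_bound_def split: if_splits)
  qed
  define y where "y k = M ^\<^sub>m k *\<^sub>v x" for k
  have y_carrier: "y k \<in> carrier_vec n" for k
    unfolding y_def by (rule mult_mat_vec_carrier[OF pow_carrier_mat[OF M(1)] x])
  \<comment> \<open>\<open>pow_mat\<close> multiplies new factors on the right; moving one to the
    left takes an induction over all start vectors.\<close>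
  have y_Suc: "y (Suc k) = M *\<^sub>v y k" for k
    unfolding y_def using x
  proof (induction k arbitrary: x)
    case 0
    then show ?case using M by auto
  next
    case (Suc k)
    have Mx: "M *\<^sub>v x \<in> carrier_vec n" using M Suc.prems by auto
    have "M ^\<^sub>m Suc (Suc k) *\<^sub>v x = M ^\<^sub>m Suc k *\<^sub>v (M *\<^sub>v x)"
      using M Suc.prems pow_carrier_mat[OF M(1), of "Suc k"]
      by (simp only: pow_mat.simps(2)[of M "Suc k"]) (rule assoc_mult_mat_vec, auto)
    also have "\<dots> = M *\<^sub>v (M ^\<^sub>m k *\<^sub>v (M *\<^sub>v x))" by (rule Suc.IH[OF Mx])
    also have "M ^\<^sub>m k *\<^sub>v (M *\<^sub>v x) = M ^\<^sub>m Suc k *\<^sub>v x"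
      using M Suc.prems pow_carrier_mat[OF M(1), of "k"]
      by (simp only: pow_mat.simps(2)) (rule assoc_mult_mat_vec[symmetric], auto)
    finally show ?case .
  qed
  define a where "a k = y k \<bullet> y k" for k
  have sq: "v \<bullet> v = (\<Sum>i<n. (v $ i)\<^sup>2)" if "v \<in> carrier_vec n" for v :: "real vec"
    using that by (auto simp: scalar_prod_def power2_eq_square lessThan_atLeast0)
  have a_eq: "a k = (\<Sum>i<n. (y k $ i)\<^sup>2)" for k
    unfolding a_def by (rule sq[OF y_carrier])
  have y_bound: "\<bar>y k $ i\<bar> \<le> (\<Sum>j<n. c * \<bar>x $ j\<bar>)" if "i < n" for i k
  proof -
    have "y k $ i = (\<Sum>j<n. (M ^\<^sub>m k) $$ (i, j) * x $ j)"
      unfolding y_def using that x M pow_carrier_mat[OF M(1), of "k"]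
      by (auto simp: scalar_prod_def lessThan_atLeast0)
    also have "\<bar>\<dots>\<bar> \<le> (\<Sum>j<n. \<bar>(M ^\<^sub>m k) $$ (i, j) * x $ j\<bar>)" by (rule sum_abs)
    also have "\<dots> \<le> (\<Sum>j<n. c * \<bar>x $ j\<bar>)"
      using entry that by (intro sum_mono) (auto simp: abs_mult intro!: mult_right_mono)
    finally show ?thesis .
  qed
  have "a 1 \<le> a 0"
  proof (rule log_convex_bounded_step_le)
    show "0 \<le> a k" for k unfolding a_eq by (intro sum_nonneg) auto
    show "(a (Suc k))\<^sup>2 \<le> a k * a (Suc (Suc k))" for k
    proof -
      \<comment> \<open>Symmetry shifts one factor \<open>M\<close> across the product;
        Cauchy-Schwarz for \<open>y k\<close> and \<open>y (Suc (Suc k))\<close> then gives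
        log-convexity.\<close>
      have "a (Suc k) = y k \<bullet> y (Suc (Suc k))"
        unfolding a_def using scalar_prod_mult_mat_vec_symmetric[OF M y_carrier[of k] y_carrier[of "Suc k"]]
        by (simp add: y_Suc)
      also have "\<dots> = (\<Sum>i<n. y k $ i * y (Suc (Suc k)) $ i)"
        using y_carrier[of "Suc (Suc k)"] by (auto simp: scalar_prod_def lessThan_atLeast0)
      finally show ?thesis
        unfolding a_eq[of k] a_eq[of "Suc (Suc k)"] using Cauchy_Schwarz_ineq_sum by metis
    qed
    show "a k \<le> (\<Sum>i<n. (\<Sum>j<n. c * \<bar>x $ j\<bar>)\<^sup>2)" for k
      unfolding a_eq by (intro sum_mono) (use order_trans[OF y_bound abs_ge_self] in \<open>simp flip: abs_le_square_iff\<close>)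
  qed
  moreover have "y 0 = x" unfolding y_def using M x by auto
  ultimately show ?thesis unfolding a_def using y_Suc[of 0] by simp
qed

text \<open>In a Schur decomposition \<open>M = P * B * Q\<close> with diagonal \<open>evs\<close>,
  the value \<open>e\<close> can occur in position 0 only. Back substitution in the triangular
  system then kills all other coordinates of an eigenvector for \<open>e\<close>, so every such
  vector is a multiple of \<open>P *\<^sub>v unit_vec n 0\<close>.\<close>

lemma simple_eigenvalue_eigenvectors:
  fixes M :: "real mat"
  assumes M: "M \<in> carrier_mat n n" 
    and cp: "char_poly M = (\<Prod>e\<leftarrow>evs. [:- e, 1:])"
    and simple: "\<And>i. i \<in> {1..<n} \<Longrightarrow> evs ! i \<noteq> e"
    and u: "u \<in> carrier_vec n" "M *\<^sub>v u = e \<cdot>\<^sub>v u" "u \<noteq> 0\<^sub>v n"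
    and v: "v \<in> carrier_vec n" "M *\<^sub>v v = e \<cdot>\<^sub>v v"
  shows "\<exists>a. v = a \<cdot>\<^sub>v u"
proof -
  obtain B P Q where schur: "schur_decomposition M evs = (B, P, Q)"
    by (cases "schur_decomposition M evs") auto
  have wit: "similar_mat_wit M B P Q" and tri: "upper_triangular B" and diag: "diag_mat B = evs"
    using schur_decomposition[OF M cp schur] by auto
  note w = similar_mat_witD2[OF M wit]
  have Bdiag: "B $$ (i, i) \<noteq> e" if "1 \<le> i" "i < n" for i
    using simple[of i] that w diag by (auto simp: diag_mat_def)
  have coords: "\<exists>c. x = P *\<^sub>v (c \<cdot>\<^sub>v unit_vec n 0)" 
    if x: "x \<in> carrier_vec n" "M *\<^sub>v x = e \<cdot>\<^sub>v x" for x
  proof -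
    define y where "y = Q *\<^sub>v x"
    have y: "y \<in> carrier_vec n" unfolding y_def using w x by auto
    have Py: "P *\<^sub>v y = x"
    proof -
      have "P *\<^sub>v y = (P * Q) *\<^sub>v x" unfolding y_def using w x
        by (intro assoc_mult_mat_vec[symmetric]) auto
      also have "\<dots> = x" using w x by auto
      finally show ?thesis .
    qed
    have By: "B *\<^sub>v y = e \<cdot>\<^sub>v y"
    proof -
      have "Q *\<^sub>v (M *\<^sub>v x) = Q *\<^sub>v ((P * B * Q) *\<^sub>v x)" using w by simp
      also have "(P * B * Q) *\<^sub>v x = P * B *\<^sub>v y"
        unfolding y_def by (rule assoc_mult_mat_vec) (use w x in auto)
      also have "\<dots> = P *\<^sub>v (B *\<^sub>v y)"
        by (rule assoc_mult_mat_vec) (use w y in auto)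
      also have "Q *\<^sub>v \<dots> = (Q * P) *\<^sub>v (B *\<^sub>v y)"
        by (rule assoc_mult_mat_vec[symmetric]) (use w y in auto)
      also have "\<dots> = B *\<^sub>v y" using w y by auto
      finally have "B *\<^sub>v y = Q *\<^sub>v (e \<cdot>\<^sub>v x)" using x by simp
      also have "\<dots> = e \<cdot>\<^sub>v y" unfolding y_def using w x by (intro mult_mat_vec) auto
      finally show ?thesis .
    qed
    \<comment> \<open>From the last row upwards: row \<open>i\<close> reduces to its diagonal term,
      because the entries left of it vanish by triangularity and the later coordinates of
      \<open>y\<close> by induction.\<close>
    have zero: "y $ i = 0" if "1 \<le> i" "i < n" for i
      using that
    proof (induction "n - i" arbitrary: i rule: less_induct)
      case less
      have "e * y $ i = (B *\<^sub>v y) $ i" using By less y by simp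
      also have "\<dots> = (\<Sum>j<n. B $$ (i, j) * y $ j)"
        using less w y by (auto simp: scalar_prod_def lessThan_atLeast0)
      also have "\<dots> = (\<Sum>j<n. if j = i then B $$ (i, i) * y $ i else 0)"
      proof (intro sum.cong refl)
        fix j assume j: "j \<in> {..<n}"
        consider "j < i" | "j = i" | "j > i" by linarith
        then show "B $$ (i, j) * y $ j = (if j = i then B $$ (i, i) * y $ i else 0)"
        proof cases
          case 1
          then show ?thesis using upper_triangularD[OF tri, of j i] less w by auto
        next
          case 3
          then show ?thesis using less.hyps[of j] less.prems j by auto
        qed auto
      qed
      also have "\<dots> = B $$ (i, i) * y $ i" using less by simp
      finally show ?case using Bdiag[of i] less by simp
    qed
    have "y = y $ 0 \<cdot>\<^sub>v unit_vec n 0"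
      using y zero by (intro eq_vecI) (auto simp: Suc_leI)
    with Py show ?thesis by metis
  qed
  obtain c where c: "u = P *\<^sub>v (c \<cdot>\<^sub>v unit_vec n 0)" using coords u by blast
  obtain c' where c': "v = P *\<^sub>v (c' \<cdot>\<^sub>v unit_vec n 0)" using coords v by blast
  let ?z = "P *\<^sub>v unit_vec n 0"
  have z: "?z \<in> carrier_vec n" using w by auto
  have uz: "u = c \<cdot>\<^sub>v ?z" unfolding c using w by (intro mult_mat_vec) auto
  have vz: "v = c' \<cdot>\<^sub>v ?z" unfolding c' using w by (intro mult_mat_vec) auto
  have "c \<noteq> 0"
  proof
    assume "c = 0"
    moreover have "0 \<cdot>\<^sub>v w = 0\<^sub>v n" if "w \<in> carrier_vec n" for w :: "real vec"
      by (intro eq_vecI) (use that in auto)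
    ultimately have "u = 0\<^sub>v n" using z uz by simp
    with u(3) show False ..
  qed
  then have "v = (c' / c) \<cdot>\<^sub>v u" unfolding uz by (subst smult_smult_assoc) (simp add: vz)
  then show ?thesis by blast
qed

section \<open>The spectral gap of an (n,d,\<lambda>)-graph as a contraction\<close>

lemma ndl_graph_card_neighbours:
  assumes "ndl_graph n d lam G" "v < n"
  shows "card {u. (v, u) \<in> parcs G} = d"
proof -
  have "out_arcs (with_proj G) v = Pair v ` {u. (v, u) \<in> parcs G}"
    by (auto simp: out_arcs_def)
  then have "out_degree (with_proj G) v = card {u. (v, u) \<in> parcs G}"
    unfolding out_degree_def by (simp add: card_image inj_on_def)
  with assms show ?thesis by (simp add: ndl_graph_def)
qed

text \<open>Subtracting \<open>d / n\<close> from every entry of the adjacency matrix removes the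
  eigenvalue \<open>d\<close> of the constant functions and changes nothing on functions with sum
  zero. After division by some \<open>tau > lam\<close> all eigenvalues have modulus below 1, so
  \<open>symmetric_contraction\<close> applies; finally \<open>tau\<close> tends to
  \<open>lam\<close>.\<close>

lemma ndl_graph_spectral_gap:
  fixes f :: "nat \<Rightarrow> real"
  assumes ndl: "ndl_graph n d lam G" and lam: "0 < lam" "lam \<le> real d / 2"
    and f: "(\<Sum>v<n. f v) = 0"
  shows "(\<Sum>v<n. (\<Sum>u | (v, u) \<in> parcs G. f u)\<^sup>2) \<le> lam\<^sup>2 * (\<Sum>v<n. (f v)\<^sup>2)"
proof (cases "n = 0")
  case False
  then have n: "n > 0" by simp
  interpret pair_graph G using ndl by (simp add: ndl_graph_def)
  define A where "A = adjacency_matrix n G"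
  have verts: "pverts G = {..<n}" using ndl by (simp add: ndl_graph_def)
  have sym: "(u, v) \<in> parcs G \<longleftrightarrow> (v, u) \<in> parcs G" for u v
    using arcs_symmetric by blast
  have nbh: "{u. (v, u) \<in> parcs G} = {u \<in> {..<n}. (v, u) \<in> parcs G}" for v
    using wellformed' verts by auto
  note deg = ndl_graph_card_neighbours[OF ndl]
  obtain evs where cp: "char_poly A = (\<Prod>e\<leftarrow>evs. [:- e, 1:])"
    and small: "\<And>i. i \<in> {1..<n} \<Longrightarrow> \<bar>evs ! i\<bar> \<le> lam"
    using ndl by (auto simp: ndl_graph_def ordered_eigenvalues_def A_def)
  have A: "A \<in> carrier_mat n n" unfolding A_def adjacency_matrix_def by simp
  have A_entry: "A $$ (i, j) = (if (i, j) \<in> parcs G then 1 else 0)" if "i < n" "j < n" for i j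
    using that unfolding A_def adjacency_matrix_def by simp
  have A_sum: "(\<Sum>j<n. of_real (A $$ (i, j)) * x j) = (\<Sum>u | (i, u) \<in> parcs G. x u)"
    if "i < n" for i and x :: "nat \<Rightarrow> 'b :: real_algebra_1"
  proof -
    have "(\<Sum>j<n. of_real (A $$ (i, j)) * x j) = (\<Sum>j<n. if (i, j) \<in> parcs G then x j else 0)"
      using that by (intro sum.cong) (auto simp: A_entry)
    also have "\<dots> = (\<Sum>u | (i, u) \<in> parcs G. x u)"
      unfolding nbh by (rule sum.inter_filter[symmetric]) simp
    finally show ?thesis .
  qed
  have A_vec: "(A *\<^sub>v x) $ i = (\<Sum>u | (i, u) \<in> parcs G. x $ u)" if "i < n" "x \<in> carrier_vec n" for i x
    using A_sum[OF that(1), of "\<lambda>j. x $ j"] that A by (simp add: scalar_prod_def lessThan_atLeast0)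
  have row_sum: "(\<Sum>j<n. A $$ (i, j)) = real d" if "i < n" for i
    using A_sum[OF that, of "\<lambda>_. 1 :: real"] deg[OF that] by simp
  have len: "length evs = n"
  proof -
    have "degree (\<Prod>e\<leftarrow>evs. [:- e, 1:]) = length evs" by (rule degree_linear_factors)
    with degree_monic_char_poly[OF A] cp show ?thesis by simp
  qed
  let ?one = "vec n (\<lambda>_. 1 :: real)"
  have one: "A *\<^sub>v ?one = real d \<cdot>\<^sub>v ?one"
    by (intro eq_vecI) (use A A_vec[of _ ?one] deg nbh in \<open>auto simp: sum.cong\<close>)
  have one_nz: "?one \<noteq> 0\<^sub>v n"
    using n by (metis index_vec index_zero_vec(1) zero_neq_one)
  have root: "z \<in> of_real ` set evs"
    if "eigenvalue (map_mat complex_of_real A) z" for z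
  proof -
    have "poly (char_poly (map_mat complex_of_real A)) z = 0"
      using that A eigenvalue_root_char_poly[of "map_mat complex_of_real A" n z] by simp
    moreover have "char_poly (map_mat complex_of_real A) = map_poly of_real (char_poly A)"
      by (rule of_real_hom.char_poly_hom[OF A])
    moreover have "map_poly complex_of_real (\<Prod>e\<leftarrow>evs. [:- e, 1:]) = (\<Prod>e\<leftarrow>evs. [:- of_real e, 1:])" for evs
    proof -
      interpret h: map_poly_comm_ring_hom complex_of_real ..
      show ?thesis by (induction evs) (simp_all add: h.hom_mult del: mult_pCons_left)
    qed
    ultimately have "poly (\<Prod>e\<leftarrow>evs. [:- of_real e, 1:]) z = 0" by (simp add: cp)
    then show ?thesis by (simp add: poly_prod_list prod_list_zero_iff) auto
  qed
  have d_root: "real d \<in> set evs"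
  proof -
    have "eigenvalue A (real d)"
      unfolding eigenvalue_def eigenvector_def using one one_nz A by (intro exI[of _ ?one]) auto
    then have "poly (char_poly A) (real d) = 0"
      using eigenvalue_root_char_poly[OF A] by simp
    then show ?thesis unfolding cp by (simp add: poly_prod_list prod_list_zero_iff) auto
  qed
  \<comment> \<open>Since \<open>lam \<le> d / 2 < d\<close>, the eigenvalue \<open>d\<close> can
    only be entry 0 of \<open>evs\<close>. Its eigenvectors are then the constant vectors, and one
    with sum zero vanishes; this is \<open>no_other\<close>.\<close>
  have simple: "evs ! i \<noteq> real d" if "i \<in> {1..<n}" for i
    using small[OF that] lam by auto
  have evs0: "evs ! 0 = real d"
    using d_root simple len unfolding in_set_conv_nth
    by (metis One_nat_def Suc_leI atLeastLessThan_iff bot_nat_0.not_eq_extremum)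
  have no_other: "x i = 0" if x: "\<And>i. i < n \<Longrightarrow> (\<Sum>j<n. A $$ (i, j) * x j) = real d * x i"
      and "(\<Sum>i<n. x i) = 0" and "i < n" for x i
  proof -
    have "A *\<^sub>v vec n x = real d \<cdot>\<^sub>v vec n x"
      by (intro eq_vecI) (use A x in \<open>auto simp: scalar_prod_def lessThan_atLeast0\<close>)
    from simple_eigenvalue_eigenvectors[OF A cp simple _ one one_nz _ this]
    obtain a where a: "vec n x = a \<cdot>\<^sub>v ?one" by auto
    have xa: "x j = a" if "j < n" for j
      using arg_cong[OF a, of "\<lambda>v. v $ j"] that by simp
    then have "real n * a = (\<Sum>i<n. x i)" by simp
    with that n have "a = 0" by simp
    with xa that show ?thesis by simp
  qed
  have gap: "(\<Sum>v<n. (\<Sum>u | (v, u) \<in> parcs G. f u)\<^sup>2) \<le> tau\<^sup>2 * (\<Sum>v<n. (f v)\<^sup>2)"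
    if tau: "lam < tau" for tau
  proof -
    define M where "M = mat n n (\<lambda>(i, j). (A $$ (i, j) - real d / real n) / tau)"
    have M: "M \<in> carrier_mat n n" unfolding M_def by simp
    have trans: "transpose_mat M = M"
      by (intro eq_matI) (auto simp: M_def A_entry sym)
    have M_entry: "M $$ (i, j) = (A $$ (i, j) - real d / real n) / tau" if "i < n" "j < n" for i j
      using that unfolding M_def by simp
    have col_sum: "(\<Sum>i<n. M $$ (i, j)) = 0" if "j < n" for j
    proof -
      have "(\<Sum>i<n. M $$ (i, j)) = (\<Sum>i<n. A $$ (j, i) - real d / real n) / tau"
        unfolding sum_divide_distrib using that by (intro sum.cong) (auto simp: M_entry A_entry sym)
      also have "\<dots> = 0" using row_sum[OF that] n by (simp add: sum_subtractf)
      finally show ?thesis .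
    qed
    have "norm z < 1" if "eigenvalue (map_mat complex_of_real M) z" for z
    proof -
      from that obtain v where v: "v \<in> carrier_vec n" "v \<noteq> 0\<^sub>v n"
        "map_mat complex_of_real M *\<^sub>v v = z \<cdot>\<^sub>v v"
        using M by (auto simp: eigenvalue_def eigenvector_def)
      have eq: "(\<Sum>j<n. of_real (M $$ (i, j)) * v $ j) = z * v $ i" if "i < n" for i
        using arg_cong[OF v(3), of "\<lambda>v. v $ i"] that v(1) M
        by (simp add: scalar_prod_def lessThan_atLeast0)
      \<comment> \<open>The columns of \<open>M\<close> sum to zero, so an eigenvector for
        \<open>z \<noteq> 0\<close> has sum zero. The subtracted constant does not act on it, which
        makes it an eigenvector of \<open>A\<close> for \<open>z * tau\<close>.\<close>
      have "z * (\<Sum>i<n. v $ i) = (\<Sum>i<n. \<Sum>j<n. of_real (M $$ (i, j)) * v $ j)"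
        using eq by (simp add: sum_distrib_left)
      also have "\<dots> = (\<Sum>j<n. \<Sum>i<n. of_real (M $$ (i, j)) * v $ j)" by (rule sum.swap)
      also have "\<dots> = (\<Sum>j<n. of_real (\<Sum>i<n. M $$ (i, j)) * v $ j)"
        by (simp add: sum_distrib_right)
      also have "\<dots> = 0" using col_sum by simp
      finally have zsum: "z = 0 \<or> (\<Sum>i<n. v $ i) = 0" by simp
      show ?thesis
      proof (cases "z = 0")
        case False
        with zsum have vsum: "(\<Sum>i<n. v $ i) = 0" by simp
        have Av: "(\<Sum>j<n. of_real (A $$ (i, j)) * v $ j) = (z * of_real tau) * v $ i" if "i < n" for i
        proof -
          have "of_real tau * (\<Sum>j<n. of_real (M $$ (i, j)) * v $ j)
            = (\<Sum>j<n. of_real (A $$ (i, j)) * v $ j - of_real (real d / real n) * v $ j)"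
            unfolding sum_distrib_left
            using that tau lam by (intro sum.cong) (auto simp: M_entry field_simps)
          also have "\<dots> = (\<Sum>j<n. of_real (A $$ (i, j)) * v $ j) - of_real (real d / real n) * (\<Sum>j<n. v $ j)"
            by (simp add: sum_subtractf sum_distrib_left)
          finally show ?thesis using vsum eq[OF that] by (simp add: mult_ac)
        qed
        have "map_mat complex_of_real A *\<^sub>v v = (z * of_real tau) \<cdot>\<^sub>v v"
          by (intro eq_vecI) (use A Av v in \<open>auto simp: scalar_prod_def lessThan_atLeast0\<close>)
        with v A have "eigenvalue (map_mat complex_of_real A) (z * of_real tau)"
          by (auto simp: eigenvalue_def eigenvector_def)
        from root[OF this] obtain i where i: "i < n" "z * of_real tau = of_real (evs ! i)"
          using len by (auto simp: in_set_conv_nth)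
        \<comment> \<open>For \<open>i = 0\<close> the real and imaginary parts of \<open>v\<close>
          would be eigenvectors of \<open>A\<close> for \<open>d\<close> with sum zero, hence
          zero.\<close>
        have "i \<noteq> 0"
        proof
          assume "i = 0"
          with i evs0 have zd: "z * of_real tau = of_real (real d)" by simp
          have Av': "(\<Sum>j<n. of_real (A $$ (i, j)) * v $ j) = of_real (real d) * v $ i" if "i < n" for i
            using Av[OF that] zd by simp
          have "Re (v $ j) = 0" if "j < n" for j
          proof (rule no_other[OF _ _ that])
            show "(\<Sum>j<n. A $$ (i, j) * Re (v $ j)) = real d * Re (v $ i)" if "i < n" for i
              using arg_cong[OF Av'[OF that], of Re] by simp
            show "(\<Sum>i<n. Re (v $ i)) = 0" using arg_cong[OF vsum, of Re] by simp
          qed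
          moreover have "Im (v $ j) = 0" if "j < n" for j
          proof (rule no_other[OF _ _ that])
            show "(\<Sum>j<n. A $$ (i, j) * Im (v $ j)) = real d * Im (v $ i)" if "i < n" for i
              using arg_cong[OF Av'[OF that], of Im] by simp
            show "(\<Sum>i<n. Im (v $ i)) = 0" using arg_cong[OF vsum, of Im] by simp
          qed
          ultimately have "v = 0\<^sub>v n"
            using v(1) by (intro eq_vecI) (auto simp: complex_eq_iff)
          with v(2) show False ..
        qed
        with small[of i] i have "norm (z * of_real tau) \<le> lam" by simp
        then have "norm z * tau \<le> lam" using tau lam by (simp add: norm_mult)
        then have "norm z * tau < 1 * tau" using tau by linarith
        from mult_right_less_imp_less[OF this] tau lam show ?thesis by simp
      qed simp
    qed
    from symmetric_contraction[OF M trans n this, of "vec n f"]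
    have le: "(M *\<^sub>v vec n f) \<bullet> (M *\<^sub>v vec n f) \<le> vec n f \<bullet> vec n f" by simp
    have Mf: "(M *\<^sub>v vec n f) $ i = (\<Sum>u | (i, u) \<in> parcs G. f u) / tau" if "i < n" for i
    proof -
      have "(M *\<^sub>v vec n f) $ i = (\<Sum>j<n. M $$ (i, j) * f j)"
        using M that by (simp add: scalar_prod_def lessThan_atLeast0)
      also have "\<dots> = (\<Sum>j<n. A $$ (i, j) * f j - real d / real n * f j) / tau"
        unfolding sum_divide_distrib using that by (intro sum.cong) (auto simp: M_entry field_simps)
      also have "\<dots> = ((\<Sum>j<n. A $$ (i, j) * f j) - real d / real n * (\<Sum>j<n. f j)) / tau"
        by (simp add: sum_subtractf sum_distrib_left)
      finally show ?thesis using A_sum[OF that, of f] f by simp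
    qed
    have "(\<Sum>v<n. (\<Sum>u | (v, u) \<in> parcs G. f u)\<^sup>2) / tau\<^sup>2 = (\<Sum>v<n. ((M *\<^sub>v vec n f) $ v)\<^sup>2)"
      by (simp add: Mf power_divide flip: sum_divide_distrib)
    also have "\<dots> = (M *\<^sub>v vec n f) \<bullet> (M *\<^sub>v vec n f)"
      using M by (simp add: scalar_prod_def[of _ "M *\<^sub>v vec n f"] lessThan_atLeast0 power2_eq_square)
    also have "\<dots> \<le> (\<Sum>v<n. (f v)\<^sup>2)"
      using le by (simp add: scalar_prod_def lessThan_atLeast0 power2_eq_square)
    finally show ?thesis using tau lam by (simp add: field_simps)
  qed
  show ?thesis
  proof (rule tendsto_lowerbound)
    show "((\<lambda>tau. tau\<^sup>2 * (\<Sum>v<n. (f v)\<^sup>2)) \<longlongrightarrow> lam\<^sup>2 * (\<Sum>v<n. (f v)\<^sup>2)) (at_right lam)"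
      by (intro tendsto_intros)
    show "\<forall>\<^sub>F tau in at_right lam. (\<Sum>v<n. (\<Sum>u | (v, u) \<in> parcs G. f u)\<^sup>2) \<le> tau\<^sup>2 * (\<Sum>v<n. (f v)\<^sup>2)"
      using eventually_at_right_less[of lam] by eventually_elim (rule gap)
  qed simp
qed simp

section \<open>Averaging over the neighbours\<close>

text \<open>From here on the spectrum enters only through the contraction \<open>gap\<close>, with
  \<open>sig\<close> standing for \<open>lam / d\<close>.\<close>

locale regular_expander =
  fixes n d :: nat and N :: "nat \<Rightarrow> nat set" and sig :: real
  assumes n_pos: "0 < n" and d_pos: "0 < d"
    and N_subset: "v < n \<Longrightarrow> N v \<subseteq> {..<n}"
    and N_card: "v < n \<Longrightarrow> card (N v) = d"
    and N_sym: "u < n \<Longrightarrow> v < n \<Longrightarrow> u \<in> N v \<longleftrightarrow> v \<in> N u"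
    and N_irrefl: "v < n \<Longrightarrow> v \<notin> N v"
    and sig_nonneg: "0 \<le> sig" and sig_le: "sig \<le> 1 / 2"
    and gap: "(\<Sum>v<n. f v) = 0 \<Longrightarrow>
      (\<Sum>v<n. (\<Sum>u\<in>N v. f u)\<^sup>2) \<le> (sig * real d)\<^sup>2 * (\<Sum>v<n. (f v)\<^sup>2)"
begin

text \<open>The transition operator of the simple random walk, acting on functions.\<close>

definition avg :: "(nat \<Rightarrow> real) \<Rightarrow> nat \<Rightarrow> real" where
  "avg f v = (\<Sum>u\<in>N v. f u) / real d"

abbreviation nrm :: "(nat \<Rightarrow> real) \<Rightarrow> real" where
  "nrm f \<equiv> L2_set f {..<n}"

definition mean :: "(nat \<Rightarrow> real) \<Rightarrow> real" where
  "mean f = (\<Sum>v<n. f v) / real n"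

section \<open>Averaging, means and the Euclidean norm\<close>

lemma finite_N: "v < n \<Longrightarrow> finite (N v)"
  using N_subset finite_subset by blast

lemma avg_const: "v < n \<Longrightarrow> avg (\<lambda>_. c) v = c"
  using N_card d_pos by (simp add: avg_def)

lemma avg_minus_const: "v < n \<Longrightarrow> avg (\<lambda>u. f u - c) v = avg f v - c"
  using N_card[of v] d_pos by (simp add: avg_def sum_subtractf diff_divide_distrib)

lemma avg_mono:
  assumes "v < n" "\<And>u. u < n \<Longrightarrow> f u \<le> g u"
  shows "avg f v \<le> avg g v"
  unfolding avg_def using assms N_subset by (intro divide_right_mono sum_mono) auto

lemma avg_cong:
  assumes "v < n" "\<And>u. u < n \<Longrightarrow> f u = g u"
  shows "avg f v = avg g v"
  using avg_mono[of v f g] avg_mono[of v g f] assms by force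

lemma avg_nonneg:
  assumes "v < n" "\<And>u. u < n \<Longrightarrow> 0 \<le> f u"
  shows "0 \<le> avg f v"
  using avg_mono[of v "\<lambda>_. 0" f] assms by (simp add: avg_const)

text \<open>Self-adjointness of \<open>avg\<close>, which comes from the symmetry of the neighbour
  relation.\<close>

lemma sum_avg_mult: "(\<Sum>v<n. avg f v * g v) = (\<Sum>v<n. f v * avg g v)"
proof -
  have exp: "(\<Sum>u\<in>N v. h u) = (\<Sum>u<n. if u \<in> N v then h u else 0)" if "v < n" for h :: "nat \<Rightarrow> real" and v
    using N_subset[OF that] by (simp add: sum.If_cases Int_absorb1)
  have "(\<Sum>v<n. avg f v * g v) = (\<Sum>v<n. \<Sum>u<n. (if u \<in> N v then f u * g v else 0) / real d)"
    unfolding avg_def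
    by (intro sum.cong refl) (auto simp: exp sum_distrib_right sum_divide_distrib intro!: sum.cong)
  also have "\<dots> = (\<Sum>u<n. \<Sum>v<n. (if u \<in> N v then f u * g v else 0) / real d)"
    by (rule sum.swap)
  also have "\<dots> = (\<Sum>v<n. f v * avg g v)"
    unfolding avg_def
    by (intro sum.cong refl) (auto simp: exp N_sym sum_distrib_left sum_divide_distrib intro!: sum.cong)
  finally show ?thesis .
qed

lemma sum_avg: "(\<Sum>v<n. avg f v) = (\<Sum>v<n. f v)"
  using sum_avg_mult[of f "\<lambda>_. 1"] by (simp add: avg_const)

lemma nrm_avg_le:
  assumes "(\<Sum>v<n. f v) = 0"
  shows "nrm (avg f) \<le> sig * nrm f"
proof -
  have "(\<Sum>v<n. (avg f v)\<^sup>2) = (\<Sum>v<n. (\<Sum>u\<in>N v. f u)\<^sup>2) / (real d)\<^sup>2"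
    by (simp add: avg_def power_divide flip: sum_divide_distrib)
  also have "\<dots> \<le> sig\<^sup>2 * (\<Sum>v<n. (f v)\<^sup>2)"
    using gap[OF assms] d_pos by (simp add: divide_le_eq power_mult_distrib mult_ac)
  finally have "nrm (avg f) \<le> sqrt (sig\<^sup>2 * (\<Sum>v<n. (f v)\<^sup>2))"
    unfolding L2_set_def by simp
  also have "\<dots> = sig * nrm f"
    using sig_nonneg by (simp add: L2_set_def real_sqrt_mult)
  finally show ?thesis .
qed

lemma sum_minus_mean: "(\<Sum>v<n. f v - mean f) = 0"
  using n_pos by (simp add: sum_subtractf mean_def)

text \<open>Pythagoras: constant functions are orthogonal to functions with sum zero.\<close>

lemma nrm_minus_mean: "(nrm f)\<^sup>2 = real n * (mean f)\<^sup>2 + (nrm (\<lambda>v. f v - mean f))\<^sup>2"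
proof -
  have "(nrm f)\<^sup>2 = (\<Sum>v<n. (mean f)\<^sup>2 + 2 * mean f * (f v - mean f) + (f v - mean f)\<^sup>2)"
    by (simp add: L2_set_def sum_nonneg power2_eq_square algebra_simps)
  also have "\<dots> = real n * (mean f)\<^sup>2 + 2 * mean f * (\<Sum>v<n. f v - mean f)
      + (\<Sum>v<n. (f v - mean f)\<^sup>2)"
    by (simp only: sum.distrib sum_distrib_left) simp
  finally show ?thesis
    by (simp only: sum_minus_mean) (simp add: L2_set_def sum_nonneg)
qed

lemma nrm_minus_mean_le: "nrm (\<lambda>v. f v - mean f) \<le> nrm f"
proof (rule power2_le_imp_le)
  have "0 \<le> real n * (mean f)\<^sup>2" by simp
  then show "(nrm (\<lambda>v. f v - mean f))\<^sup>2 \<le> (nrm f)\<^sup>2"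
    unfolding nrm_minus_mean[of f] by linarith
qed simp

section \<open>Mixing of the random walk\<close>

lemma abs_le_nrm: "v < n \<Longrightarrow> \<bar>f v\<bar> \<le> nrm f"
  using member_le_L2_set[of "{..<n}" v "\<lambda>u. \<bar>f u\<bar>"] by (simp add: L2_set_def)

lemma nrm_avg_pow_le:
  assumes "(\<Sum>v<n. f v) = 0"
  shows "nrm ((avg ^^ j) f) \<le> sig ^ j * nrm f"
proof -
  have zero: "(\<Sum>v<n. (avg ^^ j) f v) = 0" for j
    by (induction j) (use assms in \<open>auto simp: sum_avg\<close>)
  show ?thesis
  proof (induction j)
    case (Suc j)
    have "nrm ((avg ^^ Suc j) f) \<le> sig * nrm ((avg ^^ j) f)"
      using nrm_avg_le[OF zero] by simp
    also have "\<dots> \<le> sig * (sig ^ j * nrm f)"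
      using Suc sig_nonneg by (rule mult_left_mono)
    finally show ?case by simp
  qed simp
qed

lemma avg_pow_minus_const: "v < n \<Longrightarrow> (avg ^^ j) (\<lambda>u. f u - c) v = (avg ^^ j) f v - c"
proof (induction j arbitrary: v)
  case (Suc j)
  have "(avg ^^ Suc j) (\<lambda>u. f u - c) v = avg (\<lambda>u. (avg ^^ j) f u - c) v"
    using Suc by (auto intro!: avg_cong)
  then show ?case using Suc.prems by (simp add: avg_minus_const)
qed simp

text \<open>Only the part of \<open>f\<close> with sum zero changes under averaging. Its norm
  shrinks by \<open>sig\<close> in each step, and no single value exceeds the norm.\<close>

lemma avg_pow_mixing:
  assumes "v < n"
  shows "\<bar>(avg ^^ j) f v - mean f\<bar> \<le> sig ^ j * nrm f"
proof -
  let ?g = "\<lambda>u. f u - mean f"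
  have "\<bar>(avg ^^ j) f v - mean f\<bar> \<le> nrm ((avg ^^ j) ?g)"
    using abs_le_nrm[OF assms, of "(avg ^^ j) ?g"] assms by (simp add: avg_pow_minus_const)
  also have "\<dots> \<le> sig ^ j * nrm ?g"
    by (rule nrm_avg_pow_le[OF sum_minus_mean])
  also have "\<dots> \<le> sig ^ j * nrm f"
    using sig_nonneg nrm_minus_mean_le by (intro mult_left_mono) auto
  finally show ?thesis .
qed

text \<open>Split \<open>f\<close> and \<open>g\<close> into mean and fluctuation; the cross terms
  vanish. The means contribute at most \<open>c\<close>, the fluctuations at most \<open>sig\<close>
  times the product of their norms, and this product is at most
  \<open>nrm f * nrm g - c\<close>.\<close>

lemma sum_mult_avg_le:
  "(\<Sum>v<n. f v * avg g v)
    \<le> (1 - sig) * (\<bar>\<Sum>v<n. f v\<bar> * \<bar>\<Sum>v<n. g v\<bar> / real n) + sig * (nrm f * nrm g)"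
proof -
  let ?f = "\<lambda>v. f v - mean f" and ?g = "\<lambda>v. g v - mean g"
  define c where "c = real n * (\<bar>mean f\<bar> * \<bar>mean g\<bar>)"
  have c: "c = \<bar>\<Sum>v<n. f v\<bar> * \<bar>\<Sum>v<n. g v\<bar> / real n"
    using n_pos by (simp add: c_def mean_def field_simps)
  have "(\<Sum>v<n. f v * avg g v) = (\<Sum>v<n. (?f v + mean f) * (avg ?g v + mean g))"
    by (intro sum.cong) (auto simp: avg_minus_const)
  also have "\<dots> = (\<Sum>v<n. ?f v * avg ?g v) + mean g * (\<Sum>v<n. ?f v)
      + mean f * (\<Sum>v<n. avg ?g v) + real n * (mean f * mean g)"
    by (simp add: algebra_simps sum.distrib sum_subtractf sum_distrib_left)
  also have "\<dots> = (\<Sum>v<n. ?f v * avg ?g v) + real n * (mean f * mean g)"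
    by (simp only: sum_avg sum_minus_mean mult_zero_right add_0_right)
  also have "\<dots> \<le> (\<Sum>v<n. ?f v * avg ?g v) + c"
    unfolding c_def by (intro add_left_mono mult_left_mono) (auto simp flip: abs_mult)
  also have "(\<Sum>v<n. ?f v * avg ?g v) \<le> (\<Sum>v<n. \<bar>?f v\<bar> * \<bar>avg ?g v\<bar>)"
    by (intro sum_mono) (auto simp flip: abs_mult)
  also have "\<dots> \<le> nrm ?f * nrm (avg ?g)" by (rule L2_set_mult_ineq)
  also have "\<dots> \<le> nrm ?f * (sig * nrm ?g)"
    using nrm_avg_le[OF sum_minus_mean, of g] by (intro mult_left_mono) auto
  also have "\<dots> = sig * (nrm ?f * nrm ?g)" by simp
  \<comment> \<open>By \<open>nrm_minus_mean\<close> this is Cauchy-Schwarz for two vectors of the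
    plane, whose coordinates are \<open>sqrt n\<close> times the absolute mean and the norm of the
    fluctuation.\<close>
  also have "\<dots> \<le> sig * (nrm f * nrm g - c)"
  proof (intro mult_left_mono sig_nonneg)
    have cs: "(a * b + p * q)\<^sup>2 \<le> (a\<^sup>2 + p\<^sup>2) * (b\<^sup>2 + q\<^sup>2)" for a b p q :: real
      using zero_le_power2[of "a * q - b * p"] by (simp add: power2_eq_square algebra_simps)
    have "(c + nrm ?f * nrm ?g)\<^sup>2 \<le> (nrm f * nrm g)\<^sup>2"
    proof -
      let ?a = "sqrt (real n) * \<bar>mean f\<bar>" and ?b = "sqrt (real n) * \<bar>mean g\<bar>"
      have "(c + nrm ?f * nrm ?g)\<^sup>2 = (?a * ?b + nrm ?f * nrm ?g)\<^sup>2"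
        by (simp add: c_def algebra_simps)
      also have "\<dots> \<le> (?a\<^sup>2 + (nrm ?f)\<^sup>2) * (?b\<^sup>2 + (nrm ?g)\<^sup>2)"
        by (rule cs)
      also have "\<dots> = (nrm f)\<^sup>2 * (nrm g)\<^sup>2"
        by (simp only: nrm_minus_mean[of f] nrm_minus_mean[of g]) (simp add: power_mult_distrib)
      finally show ?thesis by (simp add: power_mult_distrib)
    qed
    then have "c + nrm ?f * nrm ?g \<le> nrm f * nrm g"
      by (rule power2_le_imp_le) simp
    then show "nrm ?f * nrm ?g \<le> nrm f * nrm g - c" by simp
  qed
  finally show ?thesis unfolding c[symmetric] by (simp add: algebra_simps)
qed

text \<open>Cauchy-Schwarz against the indicator function of the complement of
  \<open>S\<close>.\<close>

lemma abs_sum_le_support: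
  assumes S: "S \<subseteq> {..<n}" and f: "\<And>v. v \<in> S \<Longrightarrow> f v = 0"
  shows "\<bar>\<Sum>v<n. f v\<bar> \<le> sqrt (real (n - card S)) * nrm f"
proof -
  have "\<bar>\<Sum>v<n. f v\<bar> = \<bar>\<Sum>v<n. (if v \<in> S then 0 else 1) * f v\<bar>"
    using f by (intro arg_cong[where f = abs] sum.cong) auto
  also have "\<dots> \<le> (\<Sum>v<n. \<bar>(if v \<in> S then 0 else 1) * f v\<bar>)" by (rule sum_abs)
  also have "\<dots> \<le> nrm (\<lambda>v. if v \<in> S then 0 else 1) * nrm f"
    unfolding abs_mult by (rule L2_set_mult_ineq)
  also have "(\<Sum>v<n. ((if v \<in> S then 0 else 1) :: real)\<^sup>2) = real (n - card S)"
  proof -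
    have "(\<Sum>v<n. ((if v \<in> S then 0 else 1) :: real)\<^sup>2) = (\<Sum>v<n. if v \<in> S then 0 else 1)"
      by (intro sum.cong) auto
    also have "\<dots> = real (card ({..<n} - S))"
      by (simp add: sum.If_cases Diff_eq)
    finally show ?thesis using S by (simp add: card_Diff_subset finite_subset)
  qed
  then have "nrm (\<lambda>v. if v \<in> S then 0 else 1) = sqrt (real (n - card S))"
    by (simp add: L2_set_def)
  finally show ?thesis .
qed

text \<open>The squared norm of the restricted average \<open>?g\<close> is its inner product with
  \<open>avg f\<close>. Both \<open>?g\<close> and \<open>f\<close> vanish on \<open>S\<close>, so
  the sums in \<open>sum_mult_avg_le\<close> gain the factor \<open>1 - card S / n\<close>; dividing
  by \<open>nrm ?g\<close> gives the claim.\<close>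

lemma nrm_killed_avg_le:
  assumes S: "S \<subseteq> {..<n}" and f: "\<And>v. v \<in> S \<Longrightarrow> f v = 0"
  shows "nrm (\<lambda>v. if v \<in> S then 0 else avg f v)
    \<le> (1 - (1 - sig) * (real (card S) / real n)) * nrm f"
proof -
  let ?g = "\<lambda>v. if v \<in> S then 0 else avg f v"
  define r where "r = sqrt (real (n - card S))"
  have card: "card S \<le> n" using card_mono[OF _ S] by simp
  have "(nrm ?g)\<^sup>2 = (\<Sum>v<n. ?g v * avg f v)"
    by (simp add: L2_set_def sum_nonneg power2_eq_square) (intro sum.cong, auto)
  also have "\<dots> \<le> (1 - sig) * (\<bar>\<Sum>v<n. ?g v\<bar> * \<bar>\<Sum>v<n. f v\<bar> / real n) + sig * (nrm ?g * nrm f)"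
    by (rule sum_mult_avg_le)
  also have "\<dots> \<le> (1 - sig) * ((r * nrm ?g) * (r * nrm f) / real n)
      + sig * (nrm ?g * nrm f)"
    using sig_le abs_sum_le_support[OF S, of ?g] abs_sum_le_support[OF S, of f] f
    unfolding r_def by (intro add_right_mono mult_left_mono divide_right_mono mult_mono) auto
  also have "\<dots> = ((1 - sig) * (r * r / real n) + sig) * nrm f * nrm ?g"
    by (simp add: algebra_simps)
  also have "r * r = real (n - card S)" by (simp add: r_def)
  also have "(1 - sig) * (real (n - card S) / real n) + sig = 1 - (1 - sig) * (real (card S) / real n)"
    using card n_pos by (simp add: of_nat_diff field_simps)
  finally have le: "nrm ?g * nrm ?g
      \<le> (1 - (1 - sig) * (real (card S) / real n)) * nrm f * nrm ?g"
    by (simp add: power2_eq_square)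
  show ?thesis
  proof (cases "nrm ?g = 0")
    case True
    have "(1 - sig) * (real (card S) / real n) \<le> 1 * 1"
      using sig_nonneg sig_le card n_pos by (intro mult_mono) auto
    then show ?thesis unfolding True by simp
  next
    case False
    then have "nrm ?g > 0" by (simp add: order_less_le L2_set_nonneg)
    with le show ?thesis by (simp only: mult_le_cancel_right_pos)
  qed
qed

section \<open>Walks that avoid a set\<close>

text \<open>The probability that the random walk with \<open>m\<close> steps from a vertex avoids \<open>S\<close>.\<close>

primrec miss :: "nat set \<Rightarrow> nat \<Rightarrow> nat \<Rightarrow> real" where
  "miss S 0 v = (if v \<in> S then 0 else 1)"
| "miss S (Suc m) v = (if v \<in> S then 0 else avg (miss S m) v)"

lemma miss_in: "v \<in> S \<Longrightarrow> miss S m v = 0"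
  by (cases m) auto

lemma miss_nonneg: "v < n \<Longrightarrow> 0 \<le> miss S m v"
  by (induction m arbitrary: v) (auto intro!: avg_nonneg)

lemma miss_Suc_le: "v < n \<Longrightarrow> miss S (Suc m) v \<le> avg (miss S m) v"
  using miss_nonneg by (auto intro!: avg_nonneg)

text \<open>Dropping the condition to avoid \<open>S\<close> during the first \<open>j\<close> steps
  only enlarges the probability.\<close>

lemma miss_add_le: "v < n \<Longrightarrow> miss S (j + m) v \<le> (avg ^^ j) (miss S m) v"
proof (induction j arbitrary: v)
  case (Suc j)
  have "miss S (Suc j + m) v \<le> avg (miss S (j + m)) v"
    using miss_Suc_le[OF Suc.prems, of S "j + m"] by simp
  also have "\<dots> \<le> avg ((avg ^^ j) (miss S m)) v"
    using Suc by (intro avg_mono) auto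
  finally show ?case by simp
qed simp

context
  fixes S :: "nat set" and mu rho :: real
  assumes S: "S \<subseteq> {..<n}"
  defines "mu \<equiv> real (card S) / real n"
  defines "rho \<equiv> 1 - (1 - sig) * mu"
begin

lemma mu_le_1: "mu \<le> 1"
  unfolding mu_def using card_mono[OF _ S] n_pos by simp

lemma one_minus_mu: "real (n - card S) = (1 - mu) * real n"
  unfolding mu_def using card_mono[OF _ S] n_pos by (simp add: of_nat_diff field_simps)

lemma rho_nonneg: "0 \<le> rho"
proof -
  have "(1 - sig) * mu \<le> 1 * 1"
    using sig_nonneg sig_le mu_le_1 by (intro mult_mono) (auto simp: mu_def)
  then show ?thesis by (simp add: rho_def)
qed

text \<open>\<open>miss S 0\<close> is the indicator of the complement of \<open>S\<close>; as it
  takes only the values 0 and 1, its squared norm equals its sum. Every further step averages and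
  restricts, at a factor \<open>rho\<close>.\<close>

lemma nrm_miss_le: "nrm (miss S m) \<le> rho ^ m * sqrt ((1 - mu) * real n)"
proof (induction m)
  case 0
  have "(nrm (miss S 0))\<^sup>2 = (\<Sum>v<n. (miss S 0 v)\<^sup>2)"
    unfolding L2_set_def by (rule real_sqrt_pow2) (simp add: sum_nonneg)
  also have "\<dots> = (\<Sum>v<n. miss S 0 v)"
    by (intro sum.cong) auto
  also have "\<dots> \<le> sqrt ((1 - mu) * real n) * nrm (miss S 0)"
    using abs_sum_le_support[OF S, of "miss S 0", OF miss_in] unfolding one_minus_mu by linarith
  finally have le: "nrm (miss S 0) * nrm (miss S 0) \<le> sqrt ((1 - mu) * real n) * nrm (miss S 0)"
    by (simp only: power2_eq_square)
  have "nrm (miss S 0) \<le> sqrt ((1 - mu) * real n)"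
  proof (cases "nrm (miss S 0) = 0")
    case True
    then show ?thesis using mu_le_1 by (simp only: real_sqrt_ge_zero) simp
  next
    case False
    then have "0 < nrm (miss S 0)" using L2_set_nonneg[of "miss S 0" "{..<n}"] by linarith
    with le show ?thesis by (simp only: mult_le_cancel_right_pos)
  qed
  then show ?case by (simp only: power_0 mult_1)
next
  case (Suc m)
  have "nrm (miss S (Suc m)) = nrm (\<lambda>v. if v \<in> S then 0 else avg (miss S m) v)"
    by (intro L2_set_cong) simp_all
  also have "\<dots> \<le> rho * nrm (miss S m)"
    unfolding rho_def mu_def by (rule nrm_killed_avg_le[OF S miss_in])
  also have "\<dots> \<le> rho * (rho ^ m * sqrt ((1 - mu) * real n))"
    using Suc rho_nonneg by (rule mult_left_mono)
  finally show ?case by (simp only: power_Suc mult.assoc)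
qed

text \<open>
  The first \<open>j\<close> steps are only used to forget the starting vertex, the remaining \<open>m\<close> ones to hit \<open>S\<close>.
\<close>

lemma miss_le:
  assumes "v < n"
  shows "miss S (j + m) v \<le> rho ^ m * ((1 - mu) + sig ^ j * sqrt ((1 - mu) * real n))"
proof -
  have "miss S (j + m) v \<le> (avg ^^ j) (miss S m) v" by (rule miss_add_le[OF assms])
  also have "\<dots> \<le> mean (miss S m) + sig ^ j * nrm (miss S m)"
    using avg_pow_mixing[OF assms, of j "miss S m"] by simp
  \<comment> \<open>Bounding the mean by \<open>nrm / sqrt n\<close> would give only the factor
    \<open>sqrt (1 - mu)\<close>. Using once more that the function vanishes on \<open>S\<close>
    gives \<open>1 - mu\<close>.\<close>
  also have "mean (miss S m) \<le> sqrt ((1 - mu) * real n) * nrm (miss S m) / real n"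
    using abs_sum_le_support[OF S, of "miss S m"] unfolding mean_def
    by (intro divide_right_mono) (auto simp: miss_in one_minus_mu)
  also have "\<dots> \<le> sqrt ((1 - mu) * real n) * (rho ^ m * sqrt ((1 - mu) * real n)) / real n"
    using mu_le_1 nrm_miss_le by (intro divide_right_mono mult_left_mono) auto
  also have "\<dots> = rho ^ m * (1 - mu)"
    using n_pos mu_le_1 by (simp add: field_simps)
  finally show ?thesis
    using mult_left_mono[OF nrm_miss_le[of m], of "sig ^ j"] sig_nonneg
    by (simp add: algebra_simps)
qed

end

section \<open>Short walks between any two vertices\<close>

lemma mean_indicator: "v < n \<Longrightarrow> mean (indicator {v}) = 1 / real n"
  by (simp add: mean_def indicator_def)

lemma nrm_indicator: "v < n \<Longrightarrow> nrm (indicator {v}) = 1"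
proof -
  assume "v < n"
  have "(\<Sum>u<n. (indicator {v} u :: real)\<^sup>2) = (\<Sum>u<n. indicator {v} u)"
    by (intro sum.cong) (auto simp: indicator_def)
  with \<open>v < n\<close> show ?thesis by (simp add: L2_set_def indicator_def)
qed

text \<open>Without loops the probability of being back after one step is 0, yet mixing puts it
  within \<open>sig\<close> of \<open>1 / n\<close>. This later gives
  \<open>1 \<le> L\<close>.\<close>

lemma one_le_sig_n: "1 \<le> sig * real n"
proof -
  have "indicator {0} u = (0 :: real)" if "u \<in> N 0" for u
    using that N_irrefl[OF n_pos] by (cases "u = 0") auto
  then have "avg (indicator {0}) 0 = 0"
    unfolding avg_def by simp
  with avg_pow_mixing[OF n_pos, of 1 "indicator {0}"] n_pos
  show ?thesis by (simp add: mean_indicator nrm_indicator field_simps)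
qed

text \<open>\<open>(avg ^^ j) (indicator {v}) s\<close> is the probability of being at
  \<open>v\<close> after \<open>j\<close> steps from \<open>s\<close>. It differs from
  \<open>1 / n\<close> by less than \<open>1 / n\<close>, so it is positive and some walk of exactly
  \<open>j\<close> steps exists.\<close>

lemma reachable_in:
  assumes "s < n" "v < n" and small: "sig ^ j * real n < 1"
  shows "(s, v) \<in> {(x, y). y \<in> N x} ^^ j"
proof -
  have walk: "(x, v) \<in> {(x, y). y \<in> N x} ^^ j" if "(avg ^^ j) (indicator {v}) x \<noteq> 0" for x
    using that
  proof (induction j arbitrary: x)
    case (Suc j)
    then have "(\<Sum>y\<in>N x. (avg ^^ j) (indicator {v}) y) \<noteq> 0"
      by (auto simp: avg_def[of "(avg ^^ j) (indicator {v})"])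
    then obtain y where "y \<in> N x" "(avg ^^ j) (indicator {v}) y \<noteq> 0"
      by (rule sum.not_neutral_contains_not_neutral)
    with Suc.IH show ?case by (intro relpow_Suc_I2) auto
  qed (simp add: indicator_def split: if_splits)
  have "\<bar>(avg ^^ j) (indicator {v}) s - 1 / real n\<bar> \<le> sig ^ j"
    using avg_pow_mixing[OF assms(1), of j "indicator {v}"] assms
    by (simp add: mean_indicator nrm_indicator)
  also have "\<dots> < 1 / real n" using small n_pos by (simp add: field_simps)
  finally show ?thesis by (intro walk) auto
qed

end

section \<open>Breadth-first search\<close>

locale bfs_run =
  fixes nbrs :: "nat \<Rightarrow> nat list" and V :: "nat set" and K s :: nat
  assumes finite_V: "finite V" and s_in: "s \<in> V"
    and nbrs_subset: "v \<in> V \<Longrightarrow> set (nbrs v) \<subseteq> V"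
begin

definition edges :: "(nat \<times> nat) set" where
  "edges = {(x, y). y \<in> set (nbrs x)}"

text \<open>Tree paths run from \<open>v\<close> back to the root, so their arcs are reversed search
  edges. Minimality is measured against walks from \<open>s\<close> of any length.\<close>

definition shortest_path :: "nat \<Rightarrow> nat list \<Rightarrow> bool" where
  "shortest_path v p \<longleftrightarrow> p \<noteq> [] \<and> hd p = v \<and> last p = s \<and> set p \<subseteq> V
     \<and> set (vwalk_arcs p) \<subseteq> edges\<inverse> \<and> (\<forall>j. (s, v) \<in> edges ^^ j \<longrightarrow> length p \<le> Suc j)"

text \<open>The bound is \<open>max K 1\<close> because the root is discovered before the limit is
  first tested.\<close>

definition tree :: "(nat \<rightharpoonup> nat list) \<Rightarrow> bool" where
  "tree T \<longleftrightarrow> s \<in> dom T \<and> dom T \<subseteq> V \<and> card (dom T) \<le> max K 1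
     \<and> (\<forall>v p. T v = Some p \<longrightarrow> shortest_path v p)"

abbreviation level :: "(nat \<rightharpoonup> nat list) \<Rightarrow> nat \<Rightarrow> nat" where
  "level T v \<equiv> length (the (T v))"

text \<open>
  Levels count vertices, so the root has level 1 and \<open>(s, x) \<in> edges ^^ j\<close> bounds the level of
  \<open>x\<close> by \<open>Suc j\<close>.
\<close>

definition frontier :: "bfs_state \<Rightarrow> bool" where
  "frontier = (\<lambda>(Q, T). (\<forall>v\<in>dom T - set Q. set (nbrs v) \<subseteq> dom T)
     \<and> sorted (map (level T) Q)
     \<and> (Q \<noteq> [] \<longrightarrow> (\<forall>v\<in>set Q. level T v \<le> Suc (level T (hd Q)))
         \<and> (\<forall>j<level T (hd Q). \<forall>x. (s, x) \<in> edges ^^ j \<longrightarrow> x \<in> dom T)))"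

text \<open>The last discovery may interrupt the scan of a vertex, which breaks \<^const>\<open>frontier\<close>.\<close>

definition bfs_inv :: "bfs_state \<Rightarrow> bool" where
  "bfs_inv = (\<lambda>(Q, T). tree T \<and> set Q \<subseteq> dom T \<and> (card (dom T) < K \<longrightarrow> frontier (Q, T)))"

lemma finite_dom: "tree T \<Longrightarrow> finite (dom T)"
  using finite_V finite_subset by (auto simp: tree_def)

text \<open>Invariant of the scan of \<open>v\<close>, relative to the queue \<open>Q\<close>
  without \<open>v\<close> and the tree \<open>T\<close> at its start; \<open>us\<close> holds the
  neighbours treated so far. Once the limit is reached, further neighbours are ignored, hence the
  condition on \<open>us\<close>.\<close>

definition scan_inv :: "nat list \<Rightarrow> (nat \<rightharpoonup> nat list) \<Rightarrow> nat \<Rightarrow> nat set \<Rightarrow> bfs_state \<Rightarrow> bool" where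
  "scan_inv Q T v us = (\<lambda>(Q', T'). tree T' \<and> T \<subseteq>\<^sub>m T'
     \<and> (\<exists>new. Q' = Q @ new \<and> set new = dom T' - dom T \<and> card (dom T') = card (dom T) + length new
         \<and> (\<forall>u\<in>set new. level T' u = Suc (level T v)))
     \<and> (card (dom T') < K \<longrightarrow> us \<subseteq> dom T'))"

text \<open>The new path is shortest because of \<open>near\<close>: whatever is reachable in fewer
  than \<open>level T v\<close> steps was known before the scan, so an undiscovered \<open>u\<close>
  is at least that far away.\<close>

lemma scan_inv_discover:
  assumes inv: "scan_inv Q T v us (Q', T')" and u: "u \<in> set (nbrs v)" and v: "v \<in> dom T"
    and near: "\<And>j x. j < level T v \<Longrightarrow> (s, x) \<in> edges ^^ j \<Longrightarrow> x \<in> dom T"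
  shows "scan_inv Q T v (insert u us) (discover K v u (Q', T'))"
proof (cases "u \<in> dom T' \<or> card (dom T') \<ge> K")
  case True
  then show ?thesis using inv by (auto simp: scan_inv_def discover_def)
next
  case False
  then have u_new: "u \<notin> dom T'" and card: "card (dom T') < K" by auto
  from inv obtain new where tree: "tree T'" and le: "T \<subseteq>\<^sub>m T'" and Q': "Q' = Q @ new"
    and new: "set new = dom T' - dom T" "card (dom T') = card (dom T) + length new"
    "\<And>w. w \<in> set new \<Longrightarrow> level T' w = Suc (level T v)" and us: "us \<subseteq> dom T'"
    using card by (auto simp: scan_inv_def)
  have fin: "finite (dom T')" by (rule finite_dom[OF tree])
  have Tv: "T' v = T v" using le v by (auto simp: map_le_def)
  then obtain p where p: "T v = Some p" "T' v = Some p" using v by auto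
  have sp: "shortest_path v p" using tree p by (auto simp: tree_def)
  define T'' where "T'' = T'(u \<mapsto> u # p)"
  have disc: "discover K v u (Q', T') = (Q' @ [u], T'')"
    using False p by (auto simp: discover_def T''_def)
  have vV: "v \<in> V" using sp by (auto simp: shortest_path_def)
  have u_path: "shortest_path u (u # p)"
  proof -
    have "vwalk_arcs (u # p) = (u, v) # vwalk_arcs p"
      using sp by (cases p) (auto simp: shortest_path_def)
    moreover have "length (u # p) \<le> Suc j" if "(s, u) \<in> edges ^^ j" for j
    proof (rule ccontr)
      assume "\<not> length (u # p) \<le> Suc j"
      then have "j < level T v" using p by simp
      from near[OF this that] u_new map_le_implies_dom_le[OF le] show False by blast
    qed
    ultimately show ?thesis
      using sp u nbrs_subset[OF vV] by (auto simp: shortest_path_def edges_def)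
  qed
  have card'': "card (dom T'') = Suc (card (dom T'))"
    using fin u_new by (simp add: T''_def)
  have "tree T''"
    using tree u_path card card'' u_new
    by (auto simp: tree_def T''_def shortest_path_def[of u] split: if_splits)
  moreover have "T \<subseteq>\<^sub>m T''"
  proof -
    have "u \<notin> dom T" using map_le_implies_dom_le[OF le] u_new by blast
    then show ?thesis using le by (auto simp: map_le_def T''_def)
  qed
  moreover have "set (new @ [u]) = dom T'' - dom T"
    using new u_new map_le_implies_dom_le[OF le] by (auto simp: T''_def)
  moreover have "level T'' w = Suc (level T v)" if "w \<in> set (new @ [u])" for w
    using new that p u_new by (auto simp: T''_def)
  moreover have "insert u us \<subseteq> dom T''" using us by (auto simp: T''_def)
  moreover have "card (dom T'') = card (dom T) + length (new @ [u])"
    using card'' new by simp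
  ultimately have "scan_inv Q T v (insert u us) (Q @ (new @ [u]), T'')"
    unfolding scan_inv_def prod.case by blast
  then show ?thesis unfolding disc by (simp add: Q')
qed

lemma scan_inv_fold:
  assumes "scan_inv Q T v us st" "set xs \<subseteq> set (nbrs v)" "v \<in> dom T"
    and near: "\<And>j x. j < level T v \<Longrightarrow> (s, x) \<in> edges ^^ j \<Longrightarrow> x \<in> dom T"
  shows "scan_inv Q T v (us \<union> set xs) (fold (discover K v) xs st)"
  using assms(1,2)
proof (induction xs arbitrary: us st)
  case (Cons u xs)
  obtain Q' T' where st: "st = (Q', T')" by (cases st)
  have "scan_inv Q T v (insert u us) (discover K v u st)"
    using Cons.prems assms(3) near unfolding st by (intro scan_inv_discover) auto
  from Cons.IH[OF this] Cons.prems show ?case by simp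
qed simp

text \<open>The measure weighs an undiscovered vertex twice as much as a queue entry: each discovery
  lowers it by 2 and lengthens the queue by 1, and the scanned vertex leaves the queue.\<close>

lemma bfs_inv_step:
  assumes inv: "bfs_inv (Q, T)" and Q: "Q \<noteq> []" and card: "card (dom T) < K"
  defines "st \<equiv> fold (discover K (hd Q)) (nbrs (hd Q)) (tl Q, T)"
  shows "bfs_inv st"
    and "2 * (card V - card (dom (snd st))) + length (fst st)
      < 2 * (card V - card (dom T)) + length Q"
proof -
  obtain v R where QvR: "Q = v # R" using Q by (cases Q) auto
  obtain Q' T' where st: "st = (Q', T')" by (cases st)
  define h where "h = level T v"
  from inv card have tree: "tree T" and Qdom: "set Q \<subseteq> dom T" and front: "frontier (Q, T)"
    by (auto simp: bfs_inv_def)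
  have closed: "set (nbrs w) \<subseteq> dom T" if "w \<in> dom T" "w \<notin> set Q" for w
    using front that by (auto simp: frontier_def)
  have sorted: "sorted (map (level T) R)" and R_ge: "\<And>w. w \<in> set R \<Longrightarrow> h \<le> level T w"
    and R_le: "\<And>w. w \<in> set R \<Longrightarrow> level T w \<le> Suc h"
    and near: "\<And>j x. j < h \<Longrightarrow> (s, x) \<in> edges ^^ j \<Longrightarrow> x \<in> dom T"
    using front by (auto simp: frontier_def QvR h_def)
  have vdom: "v \<in> dom T" using Qdom QvR by simp
  have "scan_inv R T v {} (R, T)" using tree by (auto simp: scan_inv_def)
  from scan_inv_fold[OF this order_refl vdom] near
  have scan: "scan_inv R T v (set (nbrs v)) (Q', T')"
    using st by (auto simp: st_def QvR h_def)
  then obtain new where tree': "tree T'" and le: "T \<subseteq>\<^sub>m T'" and Q': "Q' = R @ new"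
    and new: "set new = dom T' - dom T" "card (dom T') = card (dom T) + length new"
    "\<And>w. w \<in> set new \<Longrightarrow> level T' w = Suc h"
    and full: "card (dom T') < K \<Longrightarrow> set (nbrs v) \<subseteq> dom T'"
    by (auto simp: scan_inv_def h_def)
  have dom_le: "dom T \<subseteq> dom T'" by (rule map_le_implies_dom_le[OF le])
  have same: "T' w = T w" if "w \<in> dom T" for w using le that by (auto simp: map_le_def)
  have Rdom: "set R \<subseteq> dom T" using Qdom QvR by simp
  have Q'dom: "set Q' \<subseteq> dom T'" using Rdom dom_le new unfolding Q' by auto
  have "frontier (Q', T')" if c: "card (dom T') < K"
  proof -
    have closed': "set (nbrs w) \<subseteq> dom T'" if "w \<in> dom T'" "w \<notin> set Q'" for w
    proof (cases "w = v")
      case True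
      then show ?thesis using full[OF c] by simp
    next
      case False
      then have "w \<in> dom T" "w \<notin> set Q" using that new unfolding Q' QvR by auto
      then show ?thesis using closed dom_le by blast
    qed
    have lev_R: "level T' w = level T w" if "w \<in> set R" for w
      by (simp add: same subsetD[OF Rdom that])
    have sorted': "sorted (map (level T') Q')"
    proof -
      have "map (level T') R = map (level T) R" using lev_R by simp
      moreover have "map (level T') new = replicate (length new) (Suc h)"
        using new(3) by (simp add: map_replicate_const[symmetric])
      ultimately have "map (level T') Q' = map (level T) R @ replicate (length new) (Suc h)"
        unfolding Q' by simp
      then show ?thesis
        using sorted R_le by (auto simp: sorted_append)
    qed
    have lev_ge: "h \<le> level T' w" if "w \<in> set Q'" for w
      using that R_ge lev_R new(3) unfolding Q' by force
    have lev_le: "level T' w \<le> Suc h" if "w \<in> set Q'" for w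
      using that R_le lev_R new(3) unfolding Q' by force
    \<comment> \<open>New only when the head of the queue has moved on to level
      \<open>Suc h\<close>. A vertex \<open>x\<close> reached in \<open>h\<close> steps then has a
      predecessor \<open>y\<close> of level at most \<open>h\<close>; the queue is sorted, so
      \<open>y\<close> has left it and all its neighbours are discovered.\<close>
    have near': "x \<in> dom T'" if ne: "Q' \<noteq> []" and j: "j < level T' (hd Q')" and x: "(s, x) \<in> edges ^^ j"
      for j x
    proof (cases "j < h")
      case True
      then show ?thesis using near x dom_le by blast
    next
      case False
      with j lev_le[of "hd Q'"] ne have jh: "j = h" and hd: "level T' (hd Q') = Suc h" by auto
      obtain p where p: "T v = Some p" using vdom by auto
      then have "h \<noteq> 0" using tree by (auto simp: h_def tree_def shortest_path_def)
      then obtain h' where h': "h = Suc h'" by (cases h) auto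
      from x obtain y where y: "(s, y) \<in> edges ^^ h'" "(y, x) \<in> edges"
        unfolding jh h' by (auto elim: relpow_Suc_E)
      have ydom: "y \<in> dom T" using near[OF _ y(1)] h' by simp
      then obtain q where q: "T y = Some q" by auto
      then have "shortest_path y q" using tree by (auto simp: tree_def)
      with y(1) have "length q \<le> h" unfolding h' shortest_path_def by blast
      then have "level T' y < level T' (hd Q')" using hd same[OF ydom] q by simp
      moreover have "level T' (hd Q') \<le> level T' w" if "w \<in> set Q'" for w
        using sorted' that by (cases Q') auto
      ultimately have "y \<notin> set Q'" using leD by blast
      with closed' ydom dom_le y(2) show ?thesis unfolding edges_def by blast
    qed
    show ?thesis
      unfolding frontier_def
      using closed' sorted' near' lev_ge lev_le
      by (auto intro: order_trans[OF lev_le])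
  qed
  with tree' Q'dom show "bfs_inv st" by (auto simp: st bfs_inv_def)
  have "card (dom T') \<le> card V"
    using tree' finite_V by (intro card_mono) (auto simp: tree_def)
  with new(2) show "2 * (card V - card (dom (snd st))) + length (fst st)
      < 2 * (card V - card (dom T)) + length Q"
    by (simp add: st Q' QvR)
qed

lemma bfs_correct:
  defines "T \<equiv> bfs nbrs K s"
  shows "tree T"
    and "card (dom T) \<ge> K \<or> (\<forall>v\<in>dom T. set (nbrs v) \<subseteq> dom T)"
proof -
  let ?b = "\<lambda>(Q, T). Q \<noteq> [] \<and> card (dom T) < K"
  let ?c = "\<lambda>(Q, T). fold (discover K (hd Q)) (nbrs (hd Q)) (tl Q, T)"
  let ?init = "([s], [s \<mapsto> [s]])"
  have init: "bfs_inv ?init"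
    using s_in by (auto simp: bfs_inv_def tree_def shortest_path_def frontier_def split: if_splits)
  have "tree (snd (while ?b ?c ?init)) \<and>
    (card (dom (snd (while ?b ?c ?init))) \<ge> K
      \<or> (\<forall>v\<in>dom (snd (while ?b ?c ?init)). set (nbrs v) \<subseteq> dom (snd (while ?b ?c ?init))))"
  proof (rule while_rule[where P = bfs_inv
        and r = "Wellfounded.measure (\<lambda>(Q, T). 2 * (card V - card (dom T)) + length Q)"])
    show "bfs_inv (?c st)" if "bfs_inv st" "?b st" for st
      using that bfs_inv_step(1)[of "fst st" "snd st"] by (cases st) auto
    show "(?c st, st) \<in> Wellfounded.measure (\<lambda>(Q, T). 2 * (card V - card (dom T)) + length Q)"
      if "bfs_inv st" "?b st" for st
      using that bfs_inv_step(2)[of "fst st" "snd st"] by (cases st) (auto simp: case_prod_beta)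
    \<comment> \<open>If the loop ends with an empty queue below the limit, \<open>frontier\<close>
      says that every discovered vertex has been scanned.\<close>
    show "tree (snd st) \<and> (card (dom (snd st)) \<ge> K \<or> (\<forall>v\<in>dom (snd st). set (nbrs v) \<subseteq> dom (snd st)))"
      if "bfs_inv st" "\<not> ?b st" for st
      using that by (cases st) (auto simp: bfs_inv_def frontier_def)
    show "bfs_inv ?init" by (rule init)
  qed simp
  then show "tree T" "card (dom T) \<ge> K \<or> (\<forall>v\<in>dom T. set (nbrs v) \<subseteq> dom T)"
    by (simp_all add: T_def bfs_def)
qed

text \<open>A closed set containing \<open>s\<close> contains everything reachable from it. This
  covers a limit \<open>K\<close> larger than the graph.\<close>

lemma bfs_exhaustive:
  assumes reach: "\<And>v. v \<in> V \<Longrightarrow> (s, v) \<in> edges ^^ j"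
  shows "card (dom (bfs nbrs K s)) \<ge> K \<or> dom (bfs nbrs K s) = V"
proof -
  let ?T = "bfs nbrs K s"
  have tree: "tree ?T" by (rule bfs_correct)
  then have s_dom: "s \<in> dom ?T" by (simp add: tree_def)
  have "dom ?T = V" if closed: "\<forall>v\<in>dom ?T. set (nbrs v) \<subseteq> dom ?T"
  proof -
    have "v \<in> dom ?T" if "(s, v) \<in> edges ^^ j" for j v
      using that
    proof (induction j arbitrary: v)
      case 0
      then show ?case using s_dom by simp
    next
      case (Suc j)
      then show ?case using closed by (auto simp: edges_def)
    qed
    with reach tree show ?thesis by (auto simp: tree_def)
  qed
  with bfs_correct(2) show ?thesis by blast
qed

end

section \<open>Random walks\<close>

lemma prob_bind_pmf:
  "measure_pmf.prob (bind_pmf p f) A = measure_pmf.expectation p (\<lambda>x. measure_pmf.prob (f x) A)"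
proof -
  have int: "integrable (measure_pmf p) (\<lambda>x. measure_pmf.prob (f x) A)"
    by (rule measure_pmf.integrable_const_bound[where B = 1]) auto
  have "ennreal (measure_pmf.prob (bind_pmf p f) A) = (\<integral>\<^sup>+x. ennreal (measure_pmf.prob (f x) A) \<partial>p)"
    by (simp only: measure_pmf.emeasure_eq_measure[symmetric] emeasure_bind_pmf)
  also have "\<dots> = ennreal (measure_pmf.expectation p (\<lambda>x. measure_pmf.prob (f x) A))"
    by (rule nn_integral_eq_integral[OF int]) auto
  finally show ?thesis by (simp add: integral_nonneg_AE)
qed

lemma prob_replicate_pmf_all:
  "measure_pmf.prob (replicate_pmf r p) {xs. set xs \<subseteq> A} = measure_pmf.prob p A ^ r"
proof (induction r)
  case (Suc r)
  have "replicate_pmf (Suc r) p = bind_pmf p (\<lambda>x. map_pmf ((#) x) (replicate_pmf r p))"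
    by (simp add: map_pmf_def)
  moreover have "measure_pmf.prob (map_pmf ((#) x) (replicate_pmf r p)) {xs. set xs \<subseteq> A}
      = indicator A x * measure_pmf.prob p A ^ r" for x
    using Suc by (cases "x \<in> A") (auto simp: vimage_def)
  ultimately show ?case by (simp add: prob_bind_pmf)
qed simp

lemma random_walk_set_pmf:
  assumes "w \<in> set_pmf (random_walk nbrs m v)" and "v \<in> V"
    and "\<And>u. u \<in> V \<Longrightarrow> nbrs u \<noteq> []" and "\<And>u. u \<in> V \<Longrightarrow> set (nbrs u) \<subseteq> V"
  shows "length w = Suc m \<and> hd w = v \<and> set w \<subseteq> V \<and> set (vwalk_arcs w) \<subseteq> {(x, y). y \<in> set (nbrs x)}"
  using assms(1,2)
proof (induction m arbitrary: v w)
  case (Suc m)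
  then obtain u w' where u: "u \<in> set (nbrs v)" and w': "w' \<in> set_pmf (random_walk nbrs m u)"
    and w: "w = v # w'"
    using assms(3) by auto
  have "u \<in> V" using u assms(4) Suc.prems by blast
  from Suc.IH[OF w' this] show ?case
    using u Suc.prems unfolding w by (cases w') auto
qed simp

context regular_expander
begin

text \<open>Conditioning on the first step yields the recursion of \<open>miss\<close>.\<close>

lemma prob_random_walk_avoids:
  assumes N: "\<And>v. v < n \<Longrightarrow> set (nbrs v) = N v" and "v < n"
  shows "measure_pmf.prob (random_walk nbrs m v) {w. set w \<inter> S = {}} = miss S m v"
  using \<open>v < n\<close>
proof (induction m arbitrary: v)
  case 0
  then show ?case by simp
next
  case (Suc m)
  have ne: "N v \<noteq> {}" using N_card[OF Suc.prems] d_pos by auto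
  have "measure_pmf.prob (map_pmf ((#) v) (random_walk nbrs m u)) {w. set w \<inter> S = {}}
      = (if v \<in> S then 0 else miss S m u)" if "u \<in> N v" for u
    using Suc.IH[of u] that N_subset[OF Suc.prems] by (auto simp: vimage_def)
  then have "measure_pmf.prob (random_walk nbrs (Suc m) v) {w. set w \<inter> S = {}}
      = (\<Sum>u\<in>N v. if v \<in> S then 0 else miss S m u) / real (card (N v))"
    using ne finite_N[OF Suc.prems] by (simp add: prob_bind_pmf N[OF Suc.prems] integral_pmf_of_set)
  also have "\<dots> = miss S (Suc m) v"
    by (simp add: avg_def N_card[OF Suc.prems])
  finally show ?case .
qed

end

section \<open>The two phases combined\<close>

lemma vwalk_arcs_append_Cons:
  "vwalk_arcs (xs @ x # ys) = vwalk_arcs (xs @ [x]) @ vwalk_arcs (x # ys)"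
  by (induction xs rule: vwalk_arcs.induct) auto

context bfs_run
begin

text \<open>The prefix \<open>xs\<close> of the walk stops just before the hit vertex, which is the
  head of the tree path, so \<open>xs\<close> has at most \<open>m\<close> vertices. By
  \<open>near\<close> a shortest tree path has at most \<open>Suc j\<close> vertices. Symmetry turns
  its reversed arcs into edges.\<close>

lemma connecting_path_correct:
  assumes T: "tree T" and sym: "edges\<inverse> \<inter> V \<times> V \<subseteq> edges"
    and near: "\<And>v. v \<in> V \<Longrightarrow> (s, v) \<in> edges ^^ j"
    and walks: "\<And>w. w \<in> set ws \<Longrightarrow>
      length w = Suc m \<and> hd w = t \<and> set w \<subseteq> V \<and> set (vwalk_arcs w) \<subseteq> edges"
    and hit: "\<exists>w\<in>set ws. set w \<inter> dom T \<noteq> {}"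
  shows "\<exists>p. connecting_path T ws = Some p \<and> p \<noteq> [] \<and> hd p = t \<and> last p = s \<and> set p \<subseteq> V
    \<and> set (vwalk_arcs p) \<subseteq> edges \<and> length p \<le> Suc (m + j)"
proof -
  obtain w where find: "List.find (\<lambda>w. \<exists>v\<in>set w. v \<in> dom T) ws = Some w"
    using hit by (cases "List.find (\<lambda>w. \<exists>v\<in>set w. v \<in> dom T) ws") (auto simp: find_None_iff)
  then have w: "w \<in> set ws" and w_hit: "\<exists>v\<in>set w. v \<in> dom T"
    by (auto simp: find_Some_iff)
  define xs where "xs = takeWhile (\<lambda>v. v \<notin> dom T) w"
  obtain x ys where xys: "dropWhile (\<lambda>v. v \<notin> dom T) w = x # ys"
    using w_hit by (cases "dropWhile (\<lambda>v. v \<notin> dom T) w") (auto simp: dropWhile_eq_Nil_conv)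
  have w_eq: "w = xs @ x # ys"
    unfolding xs_def using xys takeWhile_dropWhile_id by metis
  have "x \<in> dom T" using hd_dropWhile[of "\<lambda>v. v \<notin> dom T" w] xys by auto
  then obtain q where q: "T x = Some q" by auto
  then have sp: "shortest_path x q" using T by (auto simp: tree_def)
  then obtain q' where q': "q = x # q'" by (cases q) (auto simp: shortest_path_def)
  have xV: "x \<in> V" and W: "length w = Suc m" "hd w = t" "set w \<subseteq> V" "set (vwalk_arcs w) \<subseteq> edges"
    using walks[OF w] w_eq by auto
  have "connecting_path T ws = Some (xs @ q)"
    using find q xys by (simp add: connecting_path_def xs_def)
  moreover have "hd (xs @ q) = t" using W(2) unfolding w_eq q' by (cases xs) auto
  moreover have "set (vwalk_arcs (xs @ q)) \<subseteq> edges"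
  proof -
    have "set (vwalk_arcs q) \<subseteq> set q \<times> set q"
      by (induction q rule: vwalk_arcs.induct) auto
    then have "set (vwalk_arcs q) \<subseteq> edges"
      using sp sym unfolding shortest_path_def by blast
    with W(4) show ?thesis
      unfolding w_eq q' by (simp add: vwalk_arcs_append_Cons[of xs x ys] vwalk_arcs_append_Cons[of xs x q'])
  qed
  moreover have "length (xs @ q) \<le> Suc (m + j)"
    using W(1) near[OF xV] sp unfolding w_eq shortest_path_def by fastforce
  ultimately show ?thesis
    using sp W(3) unfolding w_eq shortest_path_def by auto
qed

end

text \<open>With \<open>x = 3 / 2 * L\<close> this leaves at least \<open>6 / 7 * L\<close> steps
  for the second half of a walk, which is what the constant 7 in the lower bound on \<open>k\<close>
  requires. From \<open>7 / 3\<close> on the crude bound \<open>x - 1\<close> suffices; smaller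
  \<open>x\<close> are settled by the values of the ceilings.\<close>

lemma ceiling_double_minus_ceiling_ge:
  fixes x :: real
  assumes "3 / 2 \<le> x"
  shows "4 / 7 * x \<le> of_int (\<lceil>2 * x\<rceil> - \<lceil>x\<rceil>)"
proof -
  have ge: "2 * x \<le> of_int \<lceil>2 * x\<rceil>" and less: "of_int \<lceil>x\<rceil> < x + 1" by linarith+
  consider "x \<le> 3 / 2" | "3 / 2 < x" "x \<le> 2" | "2 < x" "x < 7 / 3" | "7 / 3 \<le> x" by linarith
  then show ?thesis
  proof cases
    case 1
    then have "x = 3 / 2" using assms by simp
    then have "\<lceil>2 * x\<rceil> = 3" "\<lceil>x\<rceil> = 2" by (simp_all add: ceiling_eq_iff)
    then show ?thesis using 1 by simp
  next
    case 2
    then have "\<lceil>2 * x\<rceil> \<ge> 4" "\<lceil>x\<rceil> = 2" by linarith+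
    then have "(2::real) \<le> of_int (\<lceil>2 * x\<rceil> - \<lceil>x\<rceil>)" by linarith
    then show ?thesis using 2 by linarith
  next
    case 3
    then have "\<lceil>2 * x\<rceil> \<ge> 5" "\<lceil>x\<rceil> = 3" by linarith+
    then have "(2::real) \<le> of_int (\<lceil>2 * x\<rceil> - \<lceil>x\<rceil>)" by linarith
    then show ?thesis using 3 by linarith
  next
    case 4
    then show ?thesis using ge less by (simp only: of_int_diff)
  qed
qed

section \<open>Estimates in terms of the logarithm of n\<close>

locale log_regular_expander = regular_expander +
  fixes L :: real
  assumes sig_pos: "0 < sig"
  defines "L \<equiv> log (1 / sig) (real n)"
begin

lemma inverse_sig_gt_1: "1 < 1 / sig"
  using sig_pos sig_le by (simp add: field_simps)

lemma L_ge_1: "1 \<le> L"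
proof -
  have "1 / sig \<le> real n" using one_le_sig_n sig_pos by (simp add: field_simps)
  then show ?thesis
    unfolding L_def using inverse_sig_gt_1 sig_pos n_pos by (subst le_log_iff) auto
qed

text \<open>The defining property of \<open>L\<close> is that \<open>sig\<close> to the power
  \<open>L\<close> equals \<open>1 / n\<close>.\<close>

lemma sig_pow_le:
  assumes "a * L \<le> real j"
  shows "sig ^ j \<le> real n powr (- a)"
proof -
  have "sig ^ j = (1 / sig) powr (- real j)"
    using sig_pos by (simp add: powr_minus powr_realpow divide_powr_uminus field_simps)
  also have "\<dots> \<le> (1 / sig) powr (- (a * L))"
    using assms inverse_sig_gt_1 by (intro powr_mono) auto
  also have "\<dots> = ((1 / sig) powr L) powr (- a)"
    by (simp add: powr_powr mult.commute)
  also have "(1 / sig) powr L = real n"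
    unfolding L_def using inverse_sig_gt_1 sig_pos n_pos by (intro powr_log_cancel) auto
  finally show ?thesis .
qed

text \<open>After \<open>\<lceil>L\<rceil>\<close> steps the mixing error is at most
  \<open>1 / n\<close>; the extra step makes the inequality strict, as \<open>reachable_in\<close>
  requires.\<close>

lemma reachable_within:
  assumes "s < n" "v < n"
  shows "(s, v) \<in> {(x, y). y \<in> N x} ^^ Suc (nat \<lceil>L\<rceil>)"
proof (rule reachable_in[OF assms])
  have "sig ^ nat \<lceil>L\<rceil> \<le> real n powr (- 1)"
    using L_ge_1 by (intro sig_pow_le) linarith
  then have "sig ^ nat \<lceil>L\<rceil> * real n \<le> 1" using n_pos by (simp add: powr_minus field_simps)
  then have "sig * (sig ^ nat \<lceil>L\<rceil> * real n) \<le> sig * 1"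
    using sig_nonneg by (rule mult_left_mono)
  then show "sig ^ Suc (nat \<lceil>L\<rceil>) * real n < 1" using sig_le by simp
qed

lemma miss_le_exp:
  assumes S: "S \<subseteq> {..<n}" "S \<noteq> {}" and v: "v < n"
  shows "miss S (nat \<lceil>3 * L\<rceil>) v \<le> exp (- (3 / 7) * (real (card S) / real n) * L)"
proof -
  define mu where "mu = real (card S) / real n"
  define rho where "rho = 1 - (1 - sig) * mu"
  \<comment> \<open>The mixing error in \<open>miss_le\<close> carries a factor of order
    \<open>sqrt n\<close>, so bringing it down to \<open>1 / n\<close> takes
    \<open>3 / 2 * L\<close> steps instead of \<open>L\<close>.\<close>
  define j where "j = nat \<lceil>3 / 2 * L\<rceil>"
  define m where "m = nat \<lceil>3 * L\<rceil> - j"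
  have "card S \<ge> 1" using S finite_subset[OF S(1)] by (simp add: Suc_le_eq card_gt_0_iff)
  then have mu_ge: "1 / real n \<le> mu" using n_pos by (simp add: mu_def divide_right_mono)
  have mu0: "0 \<le> mu" by (simp add: mu_def)
  have mu1: "mu \<le> 1" unfolding mu_def by (rule mu_le_1[OF S(1)])
  have rho0: "0 \<le> rho" unfolding rho_def mu_def by (rule rho_nonneg[OF S(1)])
  have "\<lceil>3 / 2 * L\<rceil> \<le> \<lceil>3 * L\<rceil>" using L_ge_1 by (intro ceiling_mono) simp
  then have jm: "nat \<lceil>3 * L\<rceil> = j + m" by (simp add: j_def m_def)
  have "4 / 7 * (3 / 2 * L) \<le> of_int (\<lceil>2 * (3 / 2 * L)\<rceil> - \<lceil>3 / 2 * L\<rceil>)"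
    using L_ge_1 by (intro ceiling_double_minus_ceiling_ge) simp
  also have "\<lceil>2 * (3 / 2 * L)\<rceil> - \<lceil>3 / 2 * L\<rceil> = int m"
  proof -
    have diff: "int (nat a - nat b) = a - b" if "0 \<le> b" "b \<le> a" for a b :: int
      using that by simp
    have "0 \<le> \<lceil>3 / 2 * L\<rceil>" using L_ge_1 by linarith
    moreover have "2 * (3 / 2 * L) = 3 * L" by simp
    ultimately show ?thesis
      using \<open>\<lceil>3 / 2 * L\<rceil> \<le> \<lceil>3 * L\<rceil>\<close> by (simp only: m_def j_def diff)
  qed
  finally have m: "6 / 7 * L \<le> real m" by simp
  have "sig ^ j \<le> real n powr (- (3 / 2))"
    unfolding j_def by (intro sig_pow_le) linarith
  moreover have "sqrt ((1 - mu) * real n) \<le> real n powr (1 / 2)"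
    using mu0 n_pos by (auto simp: powr_half_sqrt intro: mult_left_le_one_le mu1)
  ultimately have "sig ^ j * sqrt ((1 - mu) * real n)
      \<le> real n powr (- (3 / 2)) * real n powr (1 / 2)"
    using mu1 by (intro mult_mono) auto
  also have "\<dots> = real n powr (- 1)" unfolding powr_add[symmetric] by simp
  also have "\<dots> = 1 / real n" using n_pos by (simp add: powr_minus_divide)
  finally have bracket: "(1 - mu) + sig ^ j * sqrt ((1 - mu) * real n) \<le> 1"
    using mu_ge by linarith
  have "mu * sig \<le> mu * (1 / 2)" using mu0 sig_le by (intro mult_left_mono)
  then have "rho \<le> 1 + - (mu / 2)" by (simp add: rho_def algebra_simps)
  also have "\<dots> \<le> exp (- (mu / 2))" by (rule exp_ge_add_one_self)
  finally have rho: "rho \<le> exp (- (mu / 2))" .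
  have "miss S (j + m) v \<le> rho ^ m * ((1 - mu) + sig ^ j * sqrt ((1 - mu) * real n))"
    unfolding rho_def mu_def by (rule miss_le[OF S(1) v])
  also have "\<dots> \<le> rho ^ m * 1" using bracket rho0 by (intro mult_left_mono) auto
  also have "\<dots> \<le> exp (- (mu / 2)) ^ m" using rho rho0 by (simp add: power_mono)
  also have "\<dots> = exp (real m * - (mu / 2))" by (rule exp_of_nat_mult[symmetric])
  also have "\<dots> \<le> exp (- (3 / 7) * mu * L)"
    using mult_left_mono[OF m mu0] by (simp add: algebra_simps)
  finally show ?thesis by (simp add: jm mu_def)
qed

end

section \<open>From graphs to the abstract setting\<close>

lemma ndl_graph_regular_expander:
  assumes ndl: "ndl_graph n d lam G" and lam: "0 < lam" "lam \<le> real d / 2"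
    and adj: "adjacency_lists G nbrs" and n: "0 < n"
  shows "log_regular_expander n d (\<lambda>v. set (nbrs v)) (lam / real d)"
proof -
  interpret pair_graph G using ndl by (simp add: ndl_graph_def)
  have verts: "pverts G = {..<n}" using ndl by (simp add: ndl_graph_def)
  have d: "0 < d" using lam by (cases "d = 0") auto
  have nb: "set (nbrs v) = {u. (v, u) \<in> parcs G}" if "v < n" for v
    using adj that verts by (simp add: adjacency_lists_def)
  have deg: "card (set (nbrs v)) = d" if "v < n" for v
    using ndl_graph_card_neighbours[OF ndl that] by (simp add: nb that)
  show ?thesis
  proof unfold_locales
    show "(\<Sum>v<n. (\<Sum>u\<in>set (nbrs v). f u)\<^sup>2) \<le> (lam / real d * real d)\<^sup>2 * (\<Sum>v<n. (f v)\<^sup>2)"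
      if "(\<Sum>v<n. f v) = 0" for f
      using ndl_graph_spectral_gap[OF ndl lam that] d by (simp add: nb)
    show "set (nbrs v) \<subseteq> {..<n}" if "v < n" for v
      using nb[OF that] wellformed'(2) verts by blast
    show "u \<in> set (nbrs v) \<longleftrightarrow> v \<in> set (nbrs u)" if "u < n" "v < n" for u v
      unfolding nb[OF that(1)] nb[OF that(2)] using arcs_symmetric by blast
    show "v \<notin> set (nbrs v)" if "v < n" for v
      unfolding nb[OF that] using no_loops' by blast
  qed (use n d lam deg in \<open>simp_all add: field_simps\<close>)
qed

section \<open>Analysis of the algorithm\<close>

locale bfs_random_walk = log_regular_expander n d "\<lambda>v. set (nbrs v)" sig L
  for n d :: nat and nbrs :: "nat \<Rightarrow> nat list" and sig L :: real +
  fixes s t :: nat and k delta :: real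
  assumes s: "s < n" and t: "t < n" and delta: "0 < delta" "delta < 1"
    and k: "sqrt (7 * real n * ln (1 / delta)) \<le> k"
begin

definition T where "T = bfs nbrs (nat \<lceil>k\<rceil>) s"
definition walk_length where "walk_length = nat \<lceil>3 * L\<rceil>"
definition walk_count where "walk_count = nat \<lceil>k / (3 * L)\<rceil>"

sublocale bfs_run nbrs "{..<n}" "nat \<lceil>k\<rceil>" s
  using s N_subset by unfold_locales auto

lemma k_pos: "0 < k"
proof -
  have "0 < sqrt (7 * real n * ln (1 / delta))" using delta n_pos by simp
  with k show ?thesis by linarith
qed

lemma tree_T: "tree T"
  unfolding T_def by (rule bfs_correct)

lemma reachable: "v < n \<Longrightarrow> (s, v) \<in> edges ^^ Suc (nat \<lceil>L\<rceil>)"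
  unfolding edges_def by (rule reachable_within[OF s])

lemma edges_symmetric: "v < n \<Longrightarrow> (v, u) \<in> edges \<Longrightarrow> (u, v) \<in> edges"
  using N_subset N_sym unfolding edges_def by blast

lemma walk_count_pos: "1 \<le> walk_count"
proof -
  have "0 < k / (3 * L)" using k_pos L_ge_1 by simp
  then show ?thesis unfolding walk_count_def by linarith
qed

lemma miss_pow_walk_count_le: "miss (dom T) walk_length t ^ walk_count \<le> delta"
proof (cases "dom T = {..<n}")
  \<comment> \<open>Here the walks already start in the tree and the miss probability is 0; its
    power is 0 because at least one walk is run.\<close>
  case True
  then show ?thesis using t delta walk_count_pos by (simp add: miss_in power_0_left)
next
  case False
  then have "nat \<lceil>k\<rceil> \<le> card (dom T)"
    using bfs_exhaustive[of "Suc (nat \<lceil>L\<rceil>)"] reachable unfolding T_def by auto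
  then have k_le: "k \<le> real (card (dom T))" by linarith
  define mu where "mu = real (card (dom T)) / real n"
  have dom: "dom T \<subseteq> {..<n}" "dom T \<noteq> {}" using tree_T by (auto simp: tree_def)
  have count: "k / (3 * L) \<le> real walk_count" unfolding walk_count_def by linarith
  \<comment> \<open>Both roundings help: the tree has at least \<open>k\<close> vertices, and at
    least \<open>k / (3 * L)\<close> walks are run.\<close>
  have "k / real n * k \<le> mu * (3 * L * real walk_count)"
    using k_le k_pos count L_ge_1 unfolding mu_def
    by (intro mult_mono divide_right_mono) (auto simp: field_simps)
  then have "k\<^sup>2 / real n \<le> 3 * mu * L * real walk_count"
    by (simp add: power2_eq_square mult_ac)
  moreover have "7 * ln (1 / delta) \<le> k\<^sup>2 / real n"
  proof -
    have "7 * real n * ln (1 / delta) \<le> k\<^sup>2" using k by (rule sqrt_le_D)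
    then show ?thesis using n_pos by (simp add: field_simps)
  qed
  ultimately have "7 * ln (1 / delta) \<le> 3 * mu * L * real walk_count" by linarith
  then have le: "ln (1 / delta) \<le> real walk_count * (3 / 7 * mu * L)" by (simp add: mult_ac)
  have "miss (dom T) walk_length t ^ walk_count \<le> exp (- (3 / 7) * mu * L) ^ walk_count"
    unfolding walk_length_def mu_def using miss_nonneg[OF t] miss_le_exp[OF dom t] by (intro power_mono) auto
  also have "\<dots> = exp (real walk_count * (- (3 / 7) * mu * L))" by (rule exp_of_nat_mult[symmetric])
  also have "\<dots> \<le> exp (ln delta)"
    using le delta by (simp only: exp_le_cancel_iff) (simp add: ln_div algebra_simps)
  also have "\<dots> = delta" using delta by simp
  finally show ?thesis .
qed

text \<open>Rounding up forces at least one walk. If \<open>k / (3 * L) \<ge> 1\<close>, rounding at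
  most doubles the number of walks and the total is of order \<open>k\<close>; otherwise the single
  walk and the tree are both of order \<open>L\<close>.\<close>

lemma card_visited_le:
  assumes "length ws = walk_count" and "\<And>w. w \<in> set ws \<Longrightarrow> length w = Suc walk_length"
  shows "real (card (dom T \<union> (\<Union>w\<in>set ws. set w)))
    \<le> (if 1 \<le> k / (3 * L) then 6 * k else 9 * L)"
proof -
  define q where "q = k / (3 * L)"
  have "card (\<Union>w\<in>set ws. set w) \<le> (\<Sum>w\<in>set ws. card (set w))" by (rule card_UN_le) simp
  also have "\<dots> \<le> (\<Sum>w\<in>set ws. Suc walk_length)"
    using order_trans[OF card_length eq_refl[OF assms(2)]] by (rule sum_mono)
  also have "\<dots> \<le> walk_count * Suc walk_length"
    using card_length[of ws] assms(1) by (simp only: sum_constant) (simp del: mult_Suc_right)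
  finally have "card (dom T \<union> (\<Union>w\<in>set ws. set w)) \<le> max (nat \<lceil>k\<rceil>) 1 + walk_count * Suc walk_length"
    using card_Un_le[of "dom T" "\<Union>w\<in>set ws. set w"] tree_T by (simp add: tree_def)
  also have "max (nat \<lceil>k\<rceil>) 1 = nat \<lceil>k\<rceil>" using k_pos by linarith
  finally have "real (card (dom T \<union> (\<Union>w\<in>set ws. set w)))
      \<le> real (nat \<lceil>k\<rceil>) + real walk_count * real (Suc walk_length)"
    by (metis of_nat_add of_nat_le_iff of_nat_mult)
  also have "real (nat \<lceil>k\<rceil>) \<le> k + 1" using k_pos by linarith
  \<comment> \<open>A walk lists fewer than \<open>3 * L + 2\<close> vertices, and
    \<open>1 \<le> L\<close>.\<close>
  also have "real walk_count * real (Suc walk_length) \<le> real walk_count * (5 * L)"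
    using L_ge_1 unfolding walk_length_def by (intro mult_left_mono) linarith+
  finally have le: "real (card (dom T \<union> (\<Union>w\<in>set ws. set w))) \<le> k + 1 + real walk_count * (5 * L)"
    by simp
  have kq: "k = q * (3 * L)" using L_ge_1 by (simp add: q_def)
  show ?thesis
  proof (cases "1 \<le> q")
    case True
    have "real walk_count \<le> 2 * q" using True unfolding walk_count_def q_def[symmetric] by linarith
    then have "real walk_count * (5 * L) \<le> 2 * q * (5 * L)" using L_ge_1 by (intro mult_right_mono) auto
    moreover have "2 * q * (5 * L) = 10 / 3 * k" by (simp add: kq)
    moreover have "1 * (3 * 1) \<le> k" unfolding kq using True L_ge_1 by (intro mult_mono) auto
    ultimately have "real (card (dom T \<union> (\<Union>w\<in>set ws. set w))) \<le> 6 * k"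
      using le by linarith
    then show ?thesis using True by (simp add: q_def)
  next
    case False
    have "\<lceil>q\<rceil> \<le> 1" using False by (simp add: ceiling_le_iff)
    then have "real walk_count \<le> 1" unfolding walk_count_def q_def[symmetric] by linarith
    then have "real walk_count * (5 * L) \<le> 1 * (5 * L)" using L_ge_1 by (intro mult_right_mono) auto
    moreover have "k \<le> 1 * (3 * L)" unfolding kq using False L_ge_1 by (intro mult_right_mono) auto
    ultimately have "real (card (dom T \<union> (\<Union>w\<in>set ws. set w))) \<le> 9 * L"
      using le L_ge_1 by linarith
    then show ?thesis using False by (simp add: q_def)
  qed
qed

text \<open>Every outcome in which some walk hits the tree satisfies all the bounds
  deterministically. By independence, the probability that none hits is a power of the miss
  probability of one walk.\<close>

lemma prob_success:
  "1 - delta \<le> measure_pmf.prob (bfs_random_walks nbrs n (1 / sig) k s t)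
    {(out, visited). \<exists>p. out = Some p \<and> p \<noteq> [] \<and> hd p = t \<and> last p = s \<and> set p \<subseteq> {..<n}
       \<and> set (vwalk_arcs p) \<subseteq> edges \<and> real (length p - 1) \<le> 7 * L
       \<and> real (card visited) \<le> (if 1 \<le> k / (3 * L) then 6 * k else 9 * L)}"
    (is "_ \<le> measure_pmf.prob _ ?good")
proof -
  let ?walks = "replicate_pmf walk_count (random_walk nbrs walk_length t)"
  let ?out = "\<lambda>ws. (connecting_path T ws, dom T \<union> (\<Union>w\<in>set ws. set w))"
  let ?miss = "{ws. set ws \<subseteq> {w. set w \<inter> dom T = {}}}"
  have alg: "bfs_random_walks nbrs n (1 / sig) k s t = map_pmf ?out ?walks"
    by (simp add: bfs_random_walks_def Let_def T_def walk_length_def walk_count_def L_def)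
  have nonempty: "nbrs u \<noteq> []" if "u \<in> {..<n}" for u
    using N_card[of u] that d_pos by auto
  have good: "?out ws \<in> ?good" if ws: "ws \<in> set_pmf ?walks" and hit: "ws \<notin> ?miss" for ws
  proof -
    have len: "length ws = walk_count" using ws by (simp add: set_replicate_pmf)
    have walk: "length w = Suc walk_length \<and> hd w = t \<and> set w \<subseteq> {..<n} \<and> set (vwalk_arcs w) \<subseteq> edges"
      if "w \<in> set ws" for w
      unfolding edges_def
      using ws that t nonempty N_subset
      by (intro random_walk_set_pmf[where m = walk_length]) (auto simp: set_replicate_pmf lists_eq_set)
    have sym: "edges\<inverse> \<inter> {..<n} \<times> {..<n} \<subseteq> edges" using edges_symmetric by auto
    have hit': "\<exists>w\<in>set ws. set w \<inter> dom T \<noteq> {}" using hit by blast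
    have "\<exists>p. connecting_path T ws = Some p \<and> p \<noteq> [] \<and> hd p = t \<and> last p = s \<and> set p \<subseteq> {..<n}
        \<and> set (vwalk_arcs p) \<subseteq> edges \<and> length p \<le> Suc (walk_length + Suc (nat \<lceil>L\<rceil>))"
      by (rule connecting_path_correct[OF tree_T sym _ walk hit']) (simp_all only: reachable lessThan_iff)
    then obtain p where p: "connecting_path T ws = Some p" "p \<noteq> []" "hd p = t" "last p = s"
      "set p \<subseteq> {..<n}" "set (vwalk_arcs p) \<subseteq> edges" "length p \<le> Suc (walk_length + Suc (nat \<lceil>L\<rceil>))"
      by blast
    \<comment> \<open>The two ceilings and the extra step give less than \<open>4 * L + 3\<close>,
      and \<open>1 \<le> L\<close>.\<close>
    have "real (length p - 1) \<le> 7 * L"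
      using p(7) L_ge_1 unfolding walk_length_def by linarith
    moreover have "real (card (dom T \<union> (\<Union>w\<in>set ws. set w))) \<le> (if 1 \<le> k / (3 * L) then 6 * k else 9 * L)"
      using len walk by (intro card_visited_le) auto
    ultimately show ?thesis using p by auto
  qed
  have "1 - delta \<le> 1 - miss (dom T) walk_length t ^ walk_count"
    using miss_pow_walk_count_le by simp
  also have "\<dots> = 1 - measure_pmf.prob ?walks ?miss"
    using t by (simp add: prob_replicate_pmf_all prob_random_walk_avoids)
  also have "\<dots> = measure_pmf.prob ?walks (- ?miss)"
    by (subst Compl_eq_Diff_UNIV, subst measure_pmf.prob_compl[simplified]) auto
  also have "\<dots> \<le> measure_pmf.prob ?walks (?out -` ?good)"
    using good by (intro measure_pmf.finite_measure_mono_AE) (auto simp: AE_measure_pmf_iff)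
  also have "\<dots> = measure_pmf.prob (bfs_random_walks nbrs n (1 / sig) k s t) ?good"
    unfolding alg measure_map_pmf ..
  finally show ?thesis .
qed

end

text \<open>The constants depend on \<open>c\<close> alone. The bound on visited nodes has two cases
  because the one walk forced by rounding up can exceed the square root when \<open>\<delta>\<close>
  is close to 1.\<close>

theorem theorem3:
  fixes c :: real
  assumes "sqrt 7 \<le> c"
  shows "\<exists>C1 > 0. \<exists>C2 > 0.
    \<forall>(n::nat) (d::nat) (lam::real) (G :: nat pair_pre_digraph) (nbrs :: nat \<Rightarrow> nat list)
      (s::nat) (t::nat) (\<delta>::real) (k::real).
      ndl_graph n d lam G \<and> 0 < lam \<and> lam \<le> real d / 2 \<and> adjacency_lists G nbrs \<and>
      s \<in> pverts G \<and> t \<in> pverts G \<and> 0 < \<delta> \<and> \<delta> < 1 \<and>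
      sqrt (7 * real n * ln (1 / \<delta>)) \<le> k \<and> k \<le> c * sqrt (real n * ln (1 / \<delta>)) \<longrightarrow>
      measure_pmf.prob (bfs_random_walks nbrs n (real d / lam) k s t)
        {(out, visited). \<exists>p. out = Some p \<and> st_path G s t p \<and>
           real (vwalk_length p) \<le> C1 * log (real d / lam) (real n) \<and>
           real (card visited) \<le> C2 *
             (if 1 \<le> k / (3 * log (real d / lam) (real n))
              then sqrt (real n * ln (1 / \<delta>))
              else log (real d / lam) (real n))}
      \<ge> 1 - \<delta>"
proof -
  have c: "0 < c" using assms by (smt (verit) real_sqrt_gt_0_iff)
  \<comment> \<open>\<open>7\<close> is the path bound of \<open>prob_success\<close>;
    \<open>6 * c + 9\<close> serves both cases of the node bound, \<open>6 * k\<close> and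
    \<open>9 * L\<close>.\<close>
  show ?thesis
  proof (rule exI[of _ 7], rule conjI, simp, rule exI[of _ "6 * c + 9"], rule conjI, use c in simp,
      intro allI impI, elim conjE)
    fix n d :: nat and lam :: real and G :: "nat pair_pre_digraph" and nbrs :: "nat \<Rightarrow> nat list"
      and s t :: nat and \<delta> k :: real
    assume ndl: "ndl_graph n d lam G" and lam: "0 < lam" "lam \<le> real d / 2"
      and adj: "adjacency_lists G nbrs" and st: "s \<in> pverts G" "t \<in> pverts G"
      and delta: "0 < \<delta>" "\<delta> < 1"
      and k_lower: "sqrt (7 * real n * ln (1 / \<delta>)) \<le> k" and k_upper: "k \<le> c * sqrt (real n * ln (1 / \<delta>))"
    have verts: "pverts G = {..<n}" using ndl by (simp add: ndl_graph_def)
    with st have "s < n" "t < n" by auto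
    interpret log_regular_expander n d "\<lambda>v. set (nbrs v)" "lam / real d" "log (1 / (lam / real d)) (real n)"
      using ndl_graph_regular_expander[OF ndl lam adj] \<open>s < n\<close> by auto
    interpret bfs_random_walk n d nbrs "lam / real d" "log (1 / (lam / real d)) (real n)" s t k \<delta>
      by unfold_locales (use \<open>s < n\<close> \<open>t < n\<close> delta k_lower in simp_all)
    let ?L = "log (real d / lam) (real n)" and ?X = "sqrt (real n * ln (1 / \<delta>))"
    have X: "0 \<le> ?X" using delta by simp
    have base: "1 / (lam / real d) = real d / lam" by simp
    have bound: "(if 1 \<le> k / (3 * ?L) then 6 * k else 9 * ?L)
        \<le> (6 * c + 9) * (if 1 \<le> k / (3 * ?L) then ?X else ?L)"
    proof -
      have "0 \<le> ?L" using L_ge_1 unfolding base by linarith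
      then have "0 \<le> c * ?L" using c by simp
      then have "9 * ?L \<le> (6 * c + 9) * ?L" by (simp add: distrib_right)
      moreover have "6 * k \<le> (6 * c + 9) * ?X"
        using k_upper X unfolding distrib_right mult.assoc by linarith
      ultimately show ?thesis by simp
    qed
    \<comment> \<open>\<open>adjacency_lists\<close> constrains \<open>nbrs\<close> at vertices
      only, hence the condition \<open>x < n\<close>.\<close>
    have edges: "(x, y) \<in> parcs G" if "(x, y) \<in> edges" "x < n" for x y
      using that adj verts by (auto simp: edges_def adjacency_lists_def)
    have path: "st_path G s t p"
      if "p \<noteq> []" "hd p = t" "last p = s" "set p \<subseteq> {..<n}" "set (vwalk_arcs p) \<subseteq> edges" for p
    proof -
      have "set (vwalk_arcs p) \<subseteq> parcs G"
      proof clarify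
        fix x y assume xy: "(x, y) \<in> set (vwalk_arcs p)"
        then have "x \<in> set p" by (induction p rule: vwalk_arcs.induct) auto
        with xy that edges show "(x, y) \<in> parcs G" by blast
      qed
      with that verts show ?thesis by (auto simp: st_path_def vwalk_def)
    qed
    have "1 - \<delta> \<le> measure_pmf.prob (bfs_random_walks nbrs n (real d / lam) k s t)
      {(out, visited). \<exists>p. out = Some p \<and> p \<noteq> [] \<and> hd p = t \<and> last p = s \<and> set p \<subseteq> {..<n}
         \<and> set (vwalk_arcs p) \<subseteq> edges \<and> real (length p - 1) \<le> 7 * ?L
         \<and> real (card visited) \<le> (if 1 \<le> k / (3 * ?L) then 6 * k else 9 * ?L)}"
      by (rule prob_success[unfolded base])
    also have "\<dots> \<le> measure_pmf.prob (bfs_random_walks nbrs n (real d / lam) k s t)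
      {(out, visited). \<exists>p. out = Some p \<and> st_path G s t p \<and> real (vwalk_length p) \<le> 7 * ?L
         \<and> real (card visited) \<le> (6 * c + 9) * (if 1 \<le> k / (3 * ?L) then ?X else ?L)}"
      using path bound by (intro measure_pmf.finite_measure_mono) (auto intro: order_trans)
    finally show "1 - \<delta> \<le> measure_pmf.prob (bfs_random_walks nbrs n (real d / lam) k s t)
      {(out, visited). \<exists>p. out = Some p \<and> st_path G s t p \<and> real (vwalk_length p) \<le> 7 * ?L
         \<and> real (card visited) \<le> (6 * c + 9) * (if 1 \<le> k / (3 * ?L) then ?X else ?L)}" .
  qed
qed

end
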